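(* Let $\mathcal{G}^{gr}$ be the infinite dimensional Grassmann algebra $\mathcal{G}=\langle 1,e_1,e_2,\dots\mid e_ie_j=-e_je_i\rangle$ with the grading whose even part is spanned by the monomials in the $e_i$ of even length and whose odd part is spanned by those of odd length. Then for $n\ge 1$: (1) $c_n^{gr,z}(\mathcal{G}^{gr})=\sum_{1\le i\le n,\ i\text{ odd}}\binom{n}{i}=2^{n-1}$ and $\delta_n^{gr}(\mathcal{G}^{gr})=\sum_{0\le i\le n,\ i\text{ even}}\binom{n}{i}=2^{n-1}$; (2) $\chi_n^{gr,z}(\mathcal{G}^{gr})=\sum_{1\le i\le n,\ i\text{ odd}}\chi_{(n-i),(1^i)}$ and $\chi_n(\Delta^{gr}(\mathcal{G}^{gr}))=\sum_{0\le i\le n,\ i\text{ even}}\chi_{(n-i),(1^i)}$.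
   Context: $F$ is a field of characteristic zero. A superalgebra is an algebra $A=A_0\oplus A_1$ with $A_iA_j\subseteq A_{i+j\bmod 2}$; $Z(A)$ is the center. $F\langle Y,Z\rangle$ is the free algebra on even variables $y_1,y_2,\dots$ and odd variables $z_1,z_2,\dots$. $\mathrm{Id}^{gr}(A)$ is the set of graded identities; $C^{gr}(A)$ is the set of central graded polynomials (zero constant term, all evaluations with even variables in $A_0$ and odd in $A_1$ lie in $Z(A)$). $P_n^{gr}$ is the span of monomials $w_{\sigma(1)}\cdots w_{\sigma(n)}$, $\sigma\in S_n$, $w_i\in\{y_i,z_i\}$; $c_n^{gr,z}(A)=\dim P_n^{gr}/(P_n^{gr}\cap C^{gr}(A))$, $\delta_n^{gr}(A)=\dim(P_n^{gr}\cap C^{gr}(A))/(P_n^{gr}\cap\mathrm{Id}^{gr}(A))$. $\mathbb{Z}_2\wr S_n$ acts on $P_n^{gr}$ by $(a_1,\dots,a_n;\sigma)y_i=y_{\sigma(i)}$, $(a_1,\dots,a_n;\sigma)z_i=a_{\sigma(i)}z_{\sigma(i)}$ ($a_j=\pm1$); $\chi_n^{gr,z}(A)$ and $\chi_n(\Delta^{gr}(A))$ denote the characters of $P_n^{gr}/(P_n^{gr}\cap C^{gr}(A))$ and $(P_n^{gr}\cap C^{gr}(A))/(P_n^{gr}\cap\mathrm{Id}^{gr}(A))$. $\chi_{\lambda,\mu}$ is the irreducible $\mathbb{Z}_2\wr S_n$-character indexed by $\lambda\vdash n-r$ (even variables) and $\mu\vdash r$ (odd variables); $1^i$ denotes the partition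 with $i$ parts equal to $1$. *)

theory Defs
  imports Main HOL.Vector_Spaces "HOL-Library.Function_Algebras" "HOL-Library.FuncSet"
          "HOL-Combinatorics.Permutations"
begin

text \<open>An element of the Grassmann algebra G = <1, e_0, e_1, ... | e_i e_j = - e_j e_i>
  over the field 'a is represented by its coefficient function on the standard basis
  e_A = e_{a_1} ... e_{a_k} (a_1 < ... < a_k), A a finite set of indices.
  (Indexing the generators by nat starting at 0 instead of 1 is immaterial.)\<close>

type_synonym 'a grass = "nat set \<Rightarrow> 'a"

definition grass_carrier :: "'a::field grass set" where
  "grass_carrier = {u. finite {A. u A \<noteq> 0} \<and> (\<forall>A. u A \<noteq> 0 \<longrightarrow> finite A)}"

text \<open>Sign obtained when reordering e_A e_B (A, B disjoint) into e_{A \<union> B}.\<close>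
definition grass_sign :: "nat set \<Rightarrow> nat set \<Rightarrow> 'a::field" where
  "grass_sign A B = (-1) ^ card {(x, y). x \<in> A \<and> y \<in> B \<and> y < x}"

definition grass_mult :: "'a::field grass \<Rightarrow> 'a grass \<Rightarrow> 'a grass" where
  "grass_mult u v = (\<lambda>C. if finite C
      then (\<Sum>A\<in>Pow C. grass_sign A (C - A) * u A * v (C - A)) else 0)"

definition grass_one :: "'a::field grass" where
  "grass_one = (\<lambda>A. if A = {} then 1 else 0)"

definition grass_prod :: "'a::field grass list \<Rightarrow> 'a grass" where
  "grass_prod us = foldr grass_mult us grass_one"

definition grass_even :: "'a::field grass set" where
  "grass_even = {u \<in> grass_carrier. \<forall>A. u A \<noteq> 0 \<longrightarrow> even (card A)}"

definition grass_odd :: "'a::field grass set" where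
  "grass_odd = {u \<in> grass_carrier. \<forall>A. u A \<noteq> 0 \<longrightarrow> odd (card A)}"

definition grass_center :: "'a::field grass set" where
  "grass_center = {u \<in> grass_carrier. \<forall>v \<in> grass_carrier. grass_mult u v = grass_mult v u}"

text \<open>Letters: Inl i is the even variable y_i, Inr i is the odd variable z_i.
  A noncommutative polynomial is a finitely supported coefficient function on words.\<close>

type_synonym 'a fpoly = "(nat + nat) list \<Rightarrow> 'a"

definition letter_index :: "nat + nat \<Rightarrow> nat" where
  "letter_index l = (case l of Inl i \<Rightarrow> i | Inr i \<Rightarrow> i)"

definition fpoly_eval :: "'a::field fpoly \<Rightarrow> (nat \<Rightarrow> 'a grass) \<Rightarrow> (nat \<Rightarrow> 'a grass) \<Rightarrow> 'a grass" where
  "fpoly_eval f ys zs = (\<lambda>C. \<Sum>w\<in>{w. f w \<noteq> 0}.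
      f w * grass_prod (map (\<lambda>l. case l of Inl i \<Rightarrow> ys i | Inr i \<Rightarrow> zs i) w) C)"

definition graded_eval_ok :: "(nat \<Rightarrow> 'a::field grass) \<Rightarrow> (nat \<Rightarrow> 'a grass) \<Rightarrow> bool" where
  "graded_eval_ok ys zs \<longleftrightarrow> (\<forall>i. ys i \<in> grass_even) \<and> (\<forall>i. zs i \<in> grass_odd)"

definition Id_gr :: "'a::field fpoly set" where
  "Id_gr = {f. finite {w. f w \<noteq> 0} \<and>
      (\<forall>ys zs. graded_eval_ok ys zs \<longrightarrow> fpoly_eval f ys zs = (\<lambda>_. 0))}"

definition C_gr :: "'a::field fpoly set" where
  "C_gr = {f. finite {w. f w \<noteq> 0} \<and> f [] = 0 \<and>
      (\<forall>ys zs. graded_eval_ok ys zs \<longrightarrow> fpoly_eval f ys zs \<in> grass_center)}"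

definition multilin_word :: "nat \<Rightarrow> (nat + nat) list \<Rightarrow> bool" where
  "multilin_word n w \<longleftrightarrow> distinct (map letter_index w) \<and> set (map letter_index w) = {1..n}"

definition P_gr :: "nat \<Rightarrow> 'a::field fpoly set" where
  "P_gr n = {f. \<forall>w. f w \<noteq> 0 \<longrightarrow> multilin_word n w}"

abbreviation fscale :: "'a::field \<Rightarrow> 'a fpoly \<Rightarrow> 'a fpoly" where
  "fscale c f \<equiv> (\<lambda>w. c * f w)"

definition fdim :: "'a::field fpoly set \<Rightarrow> nat" where
  "fdim V = vector_space.dim fscale V"

text \<open>Trace of a linear map g on the quotient V/U (U \<subseteq> V, g-invariant): take a basis B of V
  extending a basis BU of U; the classes of B - BU form a basis of V/U.\<close>
definition quot_trace :: "'a::field fpoly set \<Rightarrow> 'a fpoly set \<Rightarrow> ('a fpoly \<Rightarrow> 'a fpoly) \<Rightarrow> 'a" where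
  "quot_trace V U g = (SOME t. \<exists>BU B. BU \<subseteq> B \<and> finite B \<and>
      \<not> module.dependent fscale B \<and> module.span fscale B = V \<and> module.span fscale BU = U \<and>
      t = (\<Sum>b\<in>B - BU. module.representation fscale B (g b) b))"

definition c_gr_z :: "'a::field_char_0 itself \<Rightarrow> nat \<Rightarrow> nat" where
  "c_gr_z _ n = fdim (P_gr n :: 'a fpoly set) - fdim (P_gr n \<inter> C_gr :: 'a fpoly set)"

definition delta_gr :: "'a::field_char_0 itself \<Rightarrow> nat \<Rightarrow> nat" where
  "delta_gr _ n = fdim (P_gr n \<inter> C_gr :: 'a fpoly set) - fdim (P_gr n \<inter> Id_gr :: 'a fpoly set)"

text \<open>Action of (a_1,...,a_n; \<sigma>) \<in> Z_2 wr S_n: y_i \<mapsto> y_{\<sigma> i}, z_i \<mapsto> a_{\<sigma> i} z_{\<sigma> i},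
  extended multiplicatively and linearly. Here \<sigma> permutes {1..n}, a : nat \<Rightarrow> 'a with a j = \<plusminus>1.\<close>
definition wr_act :: "(nat \<Rightarrow> 'a::field) \<Rightarrow> (nat \<Rightarrow> nat) \<Rightarrow> 'a fpoly \<Rightarrow> 'a fpoly" where
  "wr_act a \<sigma> f = (\<lambda>w. prod_list (map (\<lambda>l. case l of Inl _ \<Rightarrow> 1 | Inr j \<Rightarrow> a j) w) *
      f (map (map_sum (inv \<sigma>) (inv \<sigma>)) w))"

definition chi_gr_z :: "nat \<Rightarrow> (nat \<Rightarrow> 'a::field_char_0) \<Rightarrow> (nat \<Rightarrow> nat) \<Rightarrow> 'a" where
  "chi_gr_z n a \<sigma> = quot_trace (P_gr n) (P_gr n \<inter> C_gr) (wr_act a \<sigma>)"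

definition chi_Delta_gr :: "nat \<Rightarrow> (nat \<Rightarrow> 'a::field_char_0) \<Rightarrow> (nat \<Rightarrow> nat) \<Rightarrow> 'a" where
  "chi_Delta_gr n a \<sigma> = quot_trace (P_gr n \<inter> C_gr) (P_gr n \<inter> Id_gr) (wr_act a \<sigma>)"

text \<open>Permutation character of the Young subgroup S_\<alpha> (composition \<alpha>, entries possibly negative,
  in which case it is 0), evaluated at a permutation \<sigma> of the finite set X:
  the number of \<sigma>-invariant ordered set partitions of X with block sizes \<alpha>.\<close>
definition young_perm_char :: "nat set \<Rightarrow> (nat \<Rightarrow> nat) \<Rightarrow> int list \<Rightarrow> int" where
  "young_perm_char X \<sigma> \<alpha> = int (card {f \<in> X \<rightarrow>\<^sub>E {..<length \<alpha>}.
      (\<forall>i<length \<alpha>. int (card {x \<in> X. f x = i}) = \<alpha> ! i) \<and> (\<forall>x\<in>X. f (\<sigma> x) = f x)})"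

text \<open>Irreducible S_X-character \<chi>_\<lambda> (\<lambda> a partition, list of weakly decreasing positive parts),
  via the Frobenius/Jacobi-Trudi determinantal formula \<chi>_\<lambda> = det(\<xi>^{(\<lambda>_i - i + j)}).\<close>
definition sym_char :: "nat list \<Rightarrow> nat set \<Rightarrow> (nat \<Rightarrow> nat) \<Rightarrow> int" where
  "sym_char lam X \<sigma> = (\<Sum>\<pi> | \<pi> permutes {..<length lam}.
      sign \<pi> * young_perm_char X \<sigma> (map (\<lambda>i. int (lam ! i) - int i + int (\<pi> i)) [0..<length lam]))"

text \<open>Irreducible character \<chi>_{\<lambda>,\<mu>} of Z_2 wr S_n, \<lambda> \<turnstile> n - r (even variables), \<mu> \<turnstile> r (odd variables):
  induced from Z_2 wr S_{n-r} \<times> Z_2 wr S_r of \<chi>_\<lambda> \<otimes> (\<epsilon> \<chi>_\<mu>), where Z_2 acts trivially on the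
  first factor and \<epsilon>(a) = \<Prod> a_j on the second. Induced character formula: sum over the \<sigma>-stable
  r-subsets T of {1..n} (the cosets fixed by (a;\<sigma>)).\<close>
definition wr_char :: "nat list \<Rightarrow> nat list \<Rightarrow> nat \<Rightarrow> (nat \<Rightarrow> 'a::field_char_0) \<Rightarrow> (nat \<Rightarrow> nat) \<Rightarrow> 'a" where
  "wr_char lam mu n a \<sigma> = (\<Sum>T | T \<subseteq> {1..n} \<and> card T = sum_list mu \<and> \<sigma> ` T = T.
      of_int (sym_char lam ({1..n} - T) \<sigma> * sym_char mu T \<sigma>) * (\<Prod>j\<in>T. a j))"

definition row_part :: "nat \<Rightarrow> nat list" where
  "row_part k = (if k = 0 then [] else [k])"

definition col_part :: "nat \<Rightarrow> nat list" where
  "col_part k = replicate k 1"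

end

theory Submission
  imports Defs "HOL-Combinatorics.Cycles" "Jordan_Normal_Form.Determinant"
begin

text \<open>
  Even elements are central and odd elements anticommute, so under a graded evaluation a multilinear
  monomial with odd variables \<open>z\<^sub>i\<close>, \<open>i \<in> T\<close>, depends only on \<open>T\<close> up to the sign of the arrangement of
  the odd letters. Hence a multilinear polynomial is described modulo identities by one signed
  coefficient sum \<open>\<phi>\<^sub>T\<close> for each \<open>T \<subseteq> {1..n}\<close>; it is an identity iff all \<open>\<phi>\<^sub>T\<close> vanish, and central
  iff those with \<open>card T\<close> odd vanish. The canonical monomials are dual to the \<open>\<phi>\<^sub>T\<close>, which yields the
  dimensions, and the trace of \<open>(a; \<sigma>)\<close> is the sum of \<open>sgn (\<sigma>|\<^sub>T) \<Prod>j\<in>T. a j\<close> over the \<open>\<sigma>\<close>-stable \<open>T\<close>.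
  It remains to see that the Jacobi--Trudi determinant of a column is the sign character: expanding
  it along the first column gives the sum of \<open>(-1) ^ (card A - 1) * sgn (\<sigma>|\<^bsub>X - A\<^esub>)\<close> over the nonempty
  \<open>\<sigma>\<close>-stable \<open>A \<subseteq> X\<close>, which telescopes by toggling one cycle of \<open>\<sigma>\<close> in and out of \<open>A\<close>.
\<close>

section \<open>Characters of columns and rows\<close>

text \<open>In the language of symmetric functions, ordered partitions into invariant blocks stand
  for products of complete functions h, and \<open>sign_on\<close> for elementary functions e. The
  telescoping sum is then \<Sum>i. (-1)^i h_i e_(m-i) = 0 for m > 0. Hooks come in because the
  Laplace expansion of a column leaves a minor whose first row is shifted by one place: the
  induction has to carry the partition (s, 1^k), with the identity s_(s,1^k) = \<Sum>j. (-1)^j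
  h_(s+j) e_(k-j), which at s = 1 collapses to e_(k+1). Everything is done for one fixed \<sigma>,
  with stable subsets in place of induced characters.

  The other obstacle is that the trace on a quotient is defined through an arbitrarily chosen
  adapted basis. Dual functionals settle this: \<Sum>t. \<phi>_t (g (d t)) does not mention that
  basis and is shown to be the value for every admissible choice. They also avoid any explicit basis
  of the identities or of the central polynomials.\<close>

definition inv_subsets :: "('b \<Rightarrow> 'b) \<Rightarrow> 'b set \<Rightarrow> 'b set set" where
  "inv_subsets \<sigma> X = {A. A \<subseteq> X \<and> \<sigma> ` A = A}"

lemma finite_inv_subsets: "finite X \<Longrightarrow> finite (inv_subsets \<sigma> X)"
  by (auto simp: inv_subsets_def)

lemma image_diff_inv:
  assumes "\<sigma> ` X = X" "\<sigma> ` A = A" "A \<subseteq> X" "inj_on \<sigma> X"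
  shows "\<sigma> ` (X - A) = X - A"
  using inj_on_image_set_diff[OF assms(4), of X A] assms by auto

lemma sign_on_Un:
  assumes "finite A" "finite B" "A \<inter> B = {}" "bij_betw \<sigma> A A" "bij_betw \<sigma> B B"
  shows "sign_on (A \<union> B) \<sigma> = sign_on A \<sigma> * sign_on B \<sigma>"
proof -
  have "restrict_id \<sigma> (A \<union> B) = restrict_id \<sigma> A \<circ> restrict_id \<sigma> B"
    using assms(3,5) by (auto simp: restrict_id_def fun_eq_iff bij_betw_def)
  moreover have "permutation (restrict_id \<sigma> A)" "permutation (restrict_id \<sigma> B)"
    using permutes_imp_permutation[OF assms(1) permutes_restrict_id[OF assms(4)]]
      permutes_imp_permutation[OF assms(2) permutes_restrict_id[OF assms(5)]] by blast+
  ultimately show ?thesis by (simp add: sign_on_def sign_compose)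
qed

lemma sign_on_empty [simp]: "sign_on {} \<sigma> = 1"
proof -
  have "restrict_id \<sigma> {} = id" by (auto simp: restrict_id_def)
  thus ?thesis by (simp add: sign_on_def)
qed

section \<open>Cycles and their signs\<close>

lemma sign_cycle_of_list:
  "cs \<noteq> [] \<Longrightarrow> distinct cs \<Longrightarrow> sign (cycle_of_list cs) = (-1) ^ (length cs - 1)"
proof (induction cs rule: cycle_of_list.induct)
  case (1 i j cs)
  have "sign (transpose i j \<circ> cycle_of_list (j # cs))
      = sign (transpose i j) * sign (cycle_of_list (j # cs))"
    by (intro sign_compose permutation_swap_id permutation_of_cycle)
  with 1 show ?case by (simp add: sign_swap_id comp_def)
qed auto

text \<open>Take for \<open>c\<close> the orbit of any point. A stable set contains an orbit or
  misses it, and a cycle of length m has sign (-1)^(m-1). The sign is written as minus (-1)^m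
  because that is the factor picked up when \<open>c\<close> moves between a set and its
  complement.\<close>

lemma exists_cycle:
  assumes "finite X" "bij_betw \<sigma> X X" "X \<noteq> {}"
  obtains c where "c \<noteq> {}" "c \<in> inv_subsets \<sigma> X" "sign_on c \<sigma> = - ((-1) ^ card c)"
    "\<And>A. A \<in> inv_subsets \<sigma> X \<Longrightarrow> c \<subseteq> A \<or> c \<inter> A = {}"
proof -
  \<comment> \<open>Orbits and cycles are taken for permutations of the whole type, so \<sigma> is
    continued by the identity outside \<open>X\<close>.\<close>
  define p where "p = restrict_id \<sigma> X"
  have pX: "p permutes X" unfolding p_def by (rule permutes_restrict_id[OF assms(2)])
  hence perm: "permutation p" using assms(1) permutes_imp_permutation by blast
  obtain a where a: "a \<in> X" using assms by auto
  define cs where "cs = support p a"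
  have cyc: "distinct cs" unfolding cs_def by (rule cycle_of_permutation[OF perm])
  have setcs: "set cs = range (\<lambda>i. (p ^^ i) a)"
    unfolding cs_def using support_set[OF perm] by simp
  have acs: "a \<in> set cs" unfolding setcs by (metis funpow_0 rangeI)
  have in_X: "(p ^^ i) a \<in> X" for i
    using a pX by (induction i) (auto simp: permutes_in_image)
  have sub: "set cs \<subseteq> X" using in_X setcs by auto
  have pe: "p x = cycle_of_list cs x" if "x \<in> set cs" for x
    using cycle_restrict[OF perm] that unfolding cs_def by blast
  have ps: "p x = \<sigma> x" if "x \<in> X" for x using that by (simp add: p_def)
  have eq: "restrict_id \<sigma> (set cs) = cycle_of_list cs"
    using pe ps sub by (fastforce simp: restrict_id_def id_outside_supp)
  have im: "\<sigma> ` set cs = set cs"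
  proof -
    have "\<sigma> ` set cs = cycle_of_list cs ` set cs"
      by (rule image_cong) (use pe ps sub in \<open>auto simp: subset_iff\<close>)
    thus ?thesis using permutes_image[OF cycle_permutes] by metis
  qed
  show ?thesis
  proof (rule that[of "set cs"])
    show "set cs \<noteq> {}" using acs by auto
    show "set cs \<in> inv_subsets \<sigma> X" using im sub by (auto simp: inv_subsets_def)
    have "cs \<noteq> []" using acs by auto
    then obtain m where "length cs = Suc m" by (cases cs) auto
    thus "sign_on (set cs) \<sigma> = - ((-1) ^ card (set cs))"
      using sign_cycle_of_list[OF \<open>cs \<noteq> []\<close> cyc] distinct_card[OF cyc]
      by (simp add: sign_on_def eq)
    fix A assume A: "A \<in> inv_subsets \<sigma> X"
    show "set cs \<subseteq> A \<or> set cs \<inter> A = {}"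
    proof (cases "a \<in> A")
      case True
      have "(p ^^ i) a \<in> A" for i
      proof (induction i)
        case (Suc i)
        thus ?case using A ps by (auto simp: inv_subsets_def)
      qed (use True in auto)
      thus ?thesis using setcs by auto
    next
      case False
      \<comment> \<open>The complement of a stable set is stable, so an orbit that starts outside
        \<open>A\<close> never enters it.\<close>
      have "\<sigma> ` (X - A) = X - A"
        using A assms(2) by (intro image_diff_inv) (auto simp: inv_subsets_def bij_betw_def)
      hence "(p ^^ i) a \<in> X - A" for i
      proof (induction i)
        case (Suc i)
        thus ?case using ps by auto
      qed (use False a in auto)
      thus ?thesis using setcs by auto
    qed
  qed
qed

lemma inv_subsets_bij_betw:
  assumes "A \<in> inv_subsets \<sigma> X" "inj_on \<sigma> X"
  shows "bij_betw \<sigma> A A"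
  using assms inj_on_subset by (auto simp: inv_subsets_def bij_betw_def)

lemma inv_subsets_diff:
  assumes "A \<in> inv_subsets \<sigma> X" "bij_betw \<sigma> X X"
  shows "bij_betw \<sigma> (X - A) (X - A)"
  using assms image_diff_inv[of \<sigma> X A] inj_on_subset[of \<sigma> X "X - A"]
  by (auto simp: inv_subsets_def bij_betw_def)

text \<open>Toggling a fixed cycle \<open>c\<close> in and out of \<open>A\<close> is sign-reversing, since \<open>c\<close> has sign
  \<open>(-1) ^ (card c - 1)\<close>.\<close>

lemma alternating_sum_sign_on_eq_0:
  assumes "finite X" "bij_betw \<sigma> X X" "X \<noteq> {}"
  shows "(\<Sum>A\<in>inv_subsets \<sigma> X. (-1) ^ card A * sign_on (X - A) \<sigma>) = 0"
proof -
  obtain c where c: "c \<noteq> {}" "c \<in> inv_subsets \<sigma> X" "sign_on c \<sigma> = - ((-1) ^ card c)"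
    "\<And>A. A \<in> inv_subsets \<sigma> X \<Longrightarrow> c \<subseteq> A \<or> c \<inter> A = {}"
    using exists_cycle[OF assms] by blast
  let ?I = "inv_subsets \<sigma> X" and ?t = "\<lambda>A. (-1) ^ card A * sign_on (X - A) \<sigma>"
  let ?I1 = "{A \<in> ?I. c \<inter> A = {}}" and ?I2 = "{A \<in> ?I. c \<subseteq> A}"
  have fin: "finite ?I" using assms(1) by (rule finite_inv_subsets)
  have inj: "inj_on \<sigma> X" using assms(2) by (simp add: bij_betw_def)
  have I: "?I = ?I1 \<union> ?I2" using c(4) by blast
  have dis: "?I1 \<inter> ?I2 = {}" using c(1) by blast
  have "sum ?t ?I = sum ?t ?I1 + sum ?t ?I2"
    by (subst I, rule sum.union_disjoint) (use fin dis in auto)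
  also have "sum ?t ?I2 = (\<Sum>A\<in>?I1. - ?t A)"
  proof (rule sum.reindex_bij_witness[of _ "\<lambda>A. A \<union> c" "\<lambda>A. A - c"])
    fix A assume A: "A \<in> ?I2"
    show "A - c \<union> c = A" using A by auto
    have "\<sigma> ` (A - c) = A - c"
      by (intro image_diff_inv)
        (use A c(2) inj inj_on_subset[OF inj] in \<open>auto simp: inv_subsets_def\<close>)
    thus *: "A - c \<in> ?I1" using A by (auto simp: inv_subsets_def)
    have fA: "finite A" using A assms(1) finite_subset by (auto simp: inv_subsets_def)
    have cd: "card A = card (A - c) + card c"
      using A fA by (metis (no_types, lifting) card_Diff_subset card_mono finite_subset le_add_diff_inverse2 mem_Collect_eq)
    have "X - (A - c) = (X - A) \<union> c" using A c(2) by (auto simp: inv_subsets_def)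
    moreover have "sign_on ((X - A) \<union> c) \<sigma> = sign_on (X - A) \<sigma> * sign_on c \<sigma>"
      by (rule sign_on_Un)
        (use A c(2) fA assms(1) finite_subset[of c A] inv_subsets_diff[OF _ assms(2), of A]
            inv_subsets_bij_betw[OF c(2) inj] in auto)
    ultimately show "- ((-1) ^ card (A - c) * sign_on (X - (A - c)) \<sigma>) = ?t A"
      by (simp add: cd c(3) power_add)
  next
    fix A assume A: "A \<in> ?I1"
    show "(A \<union> c) - c = A" using A by auto
    show "A \<union> c \<in> ?I2" using A c(2) by (auto simp: inv_subsets_def image_Un)
  qed
  finally show ?thesis by (simp add: sum_negf)
qed

text \<open>In the vanishing alternating sum the empty set contributes exactly
  \<open>sign_on X \<sigma>\<close>, and the remaining terms are its negative. The condition
  \<open>1 \<le> card B\<close> and the exponent \<open>card B - 1\<close> match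
  \<open>block_sum_hook_det\<close> at \<open>s = 1\<close>.\<close>

lemma sum_nonempty_inv_subsets:
  assumes fin: "finite X" and bij: "bij_betw \<sigma> X X" and ne: "X \<noteq> {}"
  shows "(\<Sum>B | B \<in> inv_subsets \<sigma> X \<and> 1 \<le> card B. (-1) ^ (card B - 1) * sign_on (X - B) \<sigma>)
    = sign_on X \<sigma>"
proof -
  let ?I = "inv_subsets \<sigma> X"
  have "{B. B \<in> ?I \<and> 1 \<le> card B} = ?I - {{}}"
    using finite_subset[OF _ fin] by (auto simp: inv_subsets_def card_gt_0_iff Suc_le_eq)
  hence "(\<Sum>B | B \<in> ?I \<and> 1 \<le> card B. (-1) ^ (card B - 1) * sign_on (X - B) \<sigma>)
     = (\<Sum>B\<in>?I - {{}}. (-1) ^ (card B - 1) * sign_on (X - B) \<sigma>)" by simp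
  also have "(\<Sum>B\<in>?I - {{}}. (-1) ^ (card B - 1) * sign_on (X - B) \<sigma>)
     = - (\<Sum>B\<in>?I - {{}}. (-1) ^ card B * sign_on (X - B) \<sigma>)"
    unfolding sum_negf[symmetric]
  proof (rule sum.cong, goal_cases)
    case (2 B)
    hence "card B \<noteq> 0" using finite_subset[OF _ fin] by (auto simp: inv_subsets_def)
    then obtain m where "card B = Suc m" using not0_implies_Suc by blast
    thus ?case by simp
  qed simp
  also have "(\<Sum>B\<in>?I - {{}}. (-1) ^ card B * sign_on (X - B) \<sigma>) = - sign_on X \<sigma>"
  proof -
    have "{} \<in> ?I" by (auto simp: inv_subsets_def)
    thus ?thesis
      using alternating_sum_sign_on_eq_0[OF fin bij ne] finite_inv_subsets[OF fin, of \<sigma>]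
      by (simp add: sum_diff1)
  qed
  finally show ?thesis by simp
qed

text \<open>For \<open>s = 1\<close> this is the pattern, for fixed block sizes \<open>ms\<close>, of the Jacobi--Trudi determinant of
  a column; a general \<open>s\<close> only changes the first row (it corresponds to a hook), so that
  expanding along the first column stays inside this family.\<close>

definition hook_det :: "nat \<Rightarrow> nat list \<Rightarrow> int" where
  "hook_det s ms = det (mat (length ms) (length ms)
     (\<lambda>(i, j). of_bool (if i = 0 then ms ! 0 = s + j else ms ! i + i = 1 + j)))"

lemma hook_det_single: "hook_det s [m] = of_bool (m = s)"
  by (simp add: hook_det_def det_single)

text \<open>In the first column only rows 0 and 1 can be nonzero, since row i would need
  \<open>ms ! i + i = 1\<close>. Deleting row 0 leaves the column pattern of the remaining sizes.
  Deleting row 1 keeps the first row but moves it one column to the left, which turns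
  \<open>s\<close> into \<open>Suc s\<close>.\<close>

lemma hook_det_Cons_Cons:
  "hook_det s (m0 # m1 # ms) =
     of_bool (m0 = s) * hook_det 1 (m1 # ms) - of_bool (m1 = 0) * hook_det (Suc s) (m0 # ms)"
proof -
  let ?k = "length ms" and ?L = "m0 # m1 # ms"
  let ?e = "\<lambda>i j. of_bool (if i = 0 then ?L ! 0 = s + j else ?L ! i + i = 1 + j) :: int"
  define M :: "int mat" where "M = mat (Suc (Suc ?k)) (Suc (Suc ?k)) (\<lambda>(i, j). ?e i j)"
  have M: "M \<in> carrier_mat (Suc (Suc ?k)) (Suc (Suc ?k))" by (simp add: M_def)
  have d: "dim_row M = Suc (Suc ?k)" "dim_col M = Suc (Suc ?k)" by (simp_all add: M_def)
  have "hook_det s ?L = det M" by (simp add: hook_det_def M_def)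
  also have "\<dots> = (\<Sum>i<Suc (Suc ?k). M $$ (i, 0) * cofactor M i 0)"
    by (rule laplace_expansion_column[OF M]) simp
  also have "\<dots> = M $$ (0, 0) * cofactor M 0 0 + M $$ (1, 0) * cofactor M 1 0
      + (\<Sum>i<?k. M $$ (Suc (Suc i), 0) * cofactor M (Suc (Suc i)) 0)"
    by (simp add: sum.lessThan_Suc_shift del: sum.lessThan_Suc)
  also have "(\<Sum>i<?k. M $$ (Suc (Suc i), 0) * cofactor M (Suc (Suc i)) 0) = 0"
    by (rule sum.neutral) (auto simp: M_def)
  also have "M $$ (0, 0) = of_bool (m0 = s)" by (simp add: M_def)
  also have "M $$ (1, 0) = of_bool (m1 = 0)" by (simp add: M_def)
  also have "cofactor M 0 0 = hook_det 1 (m1 # ms)"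
  proof -
    have "mat_delete M 0 0 = mat (Suc ?k) (Suc ?k)
        (\<lambda>(i, j). of_bool (if i = 0 then (m1 # ms) ! 0 = 1 + j else (m1 # ms) ! i + i = 1 + j))"
      by (rule eq_matI) (auto simp: mat_delete_def d, auto simp: M_def)
    thus ?thesis by (simp add: cofactor_def hook_det_def del: One_nat_def)
  qed
  also have "cofactor M 1 0 = - hook_det (Suc s) (m0 # ms)"
  proof -
    have "mat_delete M 1 0 = mat (Suc ?k) (Suc ?k)
        (\<lambda>(i, j). of_bool (if i = 0 then (m0 # ms) ! 0 = Suc s + j else (m0 # ms) ! i + i = 1 + j))"
      by (rule eq_matI) (auto simp: mat_delete_def d, auto simp: M_def)
    thus ?thesis by (simp add: cofactor_def hook_det_def del: One_nat_def)
  qed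
  finally show ?thesis by simp
qed

text \<open>The sum of \<open>F\<close> over the lists of block sizes of all ordered set partitions of \<open>X\<close> into \<open>k\<close>
  (possibly empty) \<open>\<sigma>\<close>-invariant blocks.\<close>

fun block_sum :: "(nat \<Rightarrow> nat) \<Rightarrow> nat \<Rightarrow> nat set \<Rightarrow> (nat list \<Rightarrow> int) \<Rightarrow> int" where
  "block_sum \<sigma> 0 X F = (if X = {} then F [] else 0)"
| "block_sum \<sigma> (Suc k) X F = (\<Sum>A\<in>inv_subsets \<sigma> X. block_sum \<sigma> k (X - A) (\<lambda>ms. F (card A # ms)))"

lemma block_sum_diff:
  "block_sum \<sigma> k X (\<lambda>ms. F ms - G ms) = block_sum \<sigma> k X F - block_sum \<sigma> k X G"
  by (induction k arbitrary: X F G) (auto simp: sum_subtractf)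

lemma block_sum_scale:
  "block_sum \<sigma> k X (\<lambda>ms. c * F ms) = c * block_sum \<sigma> k X F"
  by (induction k arbitrary: X F) (auto simp: sum_distrib_left)

text \<open>This is the expansion of the hook (s, 1^k) into terms h_(s+j) e_(k-j), evaluated at
  \<sigma>: a stable set \<open>A\<close> of size s + j carries the trivial character and its
  complement the sign. Each Laplace step splits off the sets with \<open>card A = s\<close> and
  leaves a hook with longer arm and shorter leg, entering with a minus sign.\<close>

lemma block_sum_hook_det:
  assumes "finite X" "bij_betw \<sigma> X X" "card X = k + s"
  shows "block_sum \<sigma> (Suc k) X (hook_det s) =
    (\<Sum>A | A \<in> inv_subsets \<sigma> X \<and> s \<le> card A. (-1) ^ (card A - s) * sign_on (X - A) \<sigma>)"
  using assms
proof (induction k arbitrary: X s)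
  case 0
  have *: "A = X" if "A \<in> inv_subsets \<sigma> X" "X \<subseteq> A" for A
    using that by (auto simp: inv_subsets_def)
  have "X \<in> inv_subsets \<sigma> X" using 0 by (auto simp: inv_subsets_def bij_betw_def)
  moreover have "A = X" if "A \<in> inv_subsets \<sigma> X" "s \<le> card A" for A
    using that 0 card_seteq[of X A] by (auto simp: inv_subsets_def)
  ultimately have "{A. A \<in> inv_subsets \<sigma> X \<and> s \<le> card A} = {X}" using 0 by auto
  moreover have "block_sum \<sigma> (Suc 0) X (hook_det s)
     = (\<Sum>A\<in>inv_subsets \<sigma> X. if A = X then 1 else 0)"
    using * 0 by (auto intro!: sum.cong simp: hook_det_single)
  ultimately show ?case using \<open>X \<in> inv_subsets \<sigma> X\<close> finite_inv_subsets[OF 0(1)] 0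
    by (simp add: sum.delta)
next
  case (Suc k)
  let ?I = "inv_subsets \<sigma> X"
  have fI: "finite ?I" by (rule finite_inv_subsets[OF Suc.prems(1)])
  have "block_sum \<sigma> (Suc (Suc k)) X (hook_det s) =
     (\<Sum>A\<in>?I. \<Sum>B\<in>inv_subsets \<sigma> (X - A). block_sum \<sigma> k (X - A - B)
        (\<lambda>ms. of_bool (card A = s) * hook_det 1 (card B # ms)
          - of_bool (card B = 0) * hook_det (Suc s) (card A # ms)))"
    by (simp add: hook_det_Cons_Cons)
  also have "\<dots> = (\<Sum>A\<in>?I. of_bool (card A = s) * block_sum \<sigma> (Suc k) (X - A) (hook_det 1))
      - (\<Sum>A\<in>?I. \<Sum>B\<in>inv_subsets \<sigma> (X - A). of_bool (card B = 0) *
          block_sum \<sigma> k (X - A - B) (\<lambda>ms. hook_det (Suc s) (card A # ms)))"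
    by (simp add: block_sum_diff block_sum_scale sum_subtractf sum_distrib_left)
  \<comment> \<open>The factor forces the second block \<open>B\<close> to be empty. Dropping it
    leaves partitions into one block fewer, on which the hook with arm \<open>Suc s\<close> is
    summed.\<close>
  also have "(\<Sum>A\<in>?I. \<Sum>B\<in>inv_subsets \<sigma> (X - A). of_bool (card B = 0) *
          block_sum \<sigma> k (X - A - B) (\<lambda>ms. hook_det (Suc s) (card A # ms)))
      = block_sum \<sigma> (Suc k) X (hook_det (Suc s))"
  proof -
    have "(\<Sum>B\<in>inv_subsets \<sigma> (X - A). of_bool (card B = 0) *
          block_sum \<sigma> k (X - A - B) (\<lambda>ms. hook_det (Suc s) (card A # ms)))
       = block_sum \<sigma> k (X - A) (\<lambda>ms. hook_det (Suc s) (card A # ms))" for A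
    proof -
      have fin: "finite (X - A)" using Suc.prems by auto
      have "card B = 0 \<longleftrightarrow> B = {}" if "B \<in> inv_subsets \<sigma> (X - A)" for B
        using that finite_subset[OF _ fin] by (auto simp: inv_subsets_def)
      hence "(\<Sum>B\<in>inv_subsets \<sigma> (X - A). of_bool (card B = 0) *
          block_sum \<sigma> k (X - A - B) (\<lambda>ms. hook_det (Suc s) (card A # ms)))
        = (\<Sum>B\<in>inv_subsets \<sigma> (X - A). if B = {} then
          block_sum \<sigma> k (X - A) (\<lambda>ms. hook_det (Suc s) (card A # ms)) else 0)"
        by (intro sum.cong) auto
      moreover have "{} \<in> inv_subsets \<sigma> (X - A)" by (auto simp: inv_subsets_def)
      ultimately show ?thesis using finite_inv_subsets[OF fin] by (simp add: sum.delta)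
    qed
    thus ?thesis by simp
  qed
  also have "\<dots> = (\<Sum>A | A \<in> ?I \<and> Suc s \<le> card A. (-1) ^ (card A - Suc s) * sign_on (X - A) \<sigma>)"
    using Suc.prems by (intro Suc.IH) auto
  \<comment> \<open>What remains after a block of size \<open>s\<close> has \<open>k + 1\<close>
    elements, so the induction hypothesis applies at arm 1, where the sum over nonempty stable sets
    collapses to a sign.\<close>
  also have "(\<Sum>A\<in>?I. of_bool (card A = s) * block_sum \<sigma> (Suc k) (X - A) (hook_det 1))
      = (\<Sum>A | A \<in> ?I \<and> card A = s. sign_on (X - A) \<sigma>)"
  proof -
    have "block_sum \<sigma> (Suc k) (X - A) (hook_det 1) = sign_on (X - A) \<sigma>"
      if A: "A \<in> ?I" "card A = s" for A
    proof -
      let ?Y = "X - A"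
      let ?J = "inv_subsets \<sigma> ?Y"
      have fin: "finite ?Y" using Suc.prems by auto
      have bij: "bij_betw \<sigma> ?Y ?Y" by (rule inv_subsets_diff[OF A(1) Suc.prems(2)])
      have cY: "card ?Y = k + 1"
        using A Suc.prems card_Diff_subset[of A X] finite_subset[of A X] by (auto simp: inv_subsets_def)
      have "block_sum \<sigma> (Suc k) ?Y (hook_det 1)
        = (\<Sum>B | B \<in> ?J \<and> 1 \<le> card B. (-1) ^ (card B - 1) * sign_on (?Y - B) \<sigma>)"
        by (rule Suc.IH[OF fin bij cY])
      also have "\<dots> = sign_on ?Y \<sigma>"
        by (rule sum_nonempty_inv_subsets[OF fin bij])
          (use cY in \<open>metis Suc_eq_plus1 card.empty nat.distinct(1)\<close>)
      finally show ?thesis .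
    qed
    thus ?thesis using fI by (simp add: of_bool_def sum.If_cases if_distrib[of "\<lambda>x. x * _"] Int_def cong: if_cong)
  qed
  also have "(\<Sum>A | A \<in> ?I \<and> card A = s. sign_on (X - A) \<sigma>)
      - (\<Sum>A | A \<in> ?I \<and> Suc s \<le> card A. (-1) ^ (card A - Suc s) * sign_on (X - A) \<sigma>)
    = (\<Sum>A | A \<in> ?I \<and> card A = s. (-1) ^ (card A - s) * sign_on (X - A) \<sigma>)
      + (\<Sum>A | A \<in> ?I \<and> Suc s \<le> card A. (-1) ^ (card A - s) * sign_on (X - A) \<sigma>)"
  proof -
    have "(-1::int) ^ (card A - s) = - ((-1) ^ (card A - Suc s))" if "Suc s \<le> card A" for A :: "nat set"
    proof -
      have "card A - s = Suc (card A - Suc s)" using that by simp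
      thus ?thesis by simp
    qed
    hence "(\<Sum>A | A \<in> ?I \<and> Suc s \<le> card A. (-1) ^ (card A - s) * sign_on (X - A) \<sigma>)
      = (\<Sum>A | A \<in> ?I \<and> Suc s \<le> card A. - ((-1) ^ (card A - Suc s) * sign_on (X - A) \<sigma>))"
      by (intro sum.cong) auto
    thus ?thesis by (simp add: sum_negf)
  qed
  also have "\<dots> = (\<Sum>A | A \<in> ?I \<and> s \<le> card A. (-1) ^ (card A - s) * sign_on (X - A) \<sigma>)"
    by (subst sum.union_disjoint[symmetric]) (use fI in \<open>auto intro!: sum.cong\<close>)
  finally show ?case .
qed

text \<open>An invariant function is the same as the list of its fibres, all of them stable.
  Splitting off the fibre over 0 and lowering the other values by one reproduces the recursion of
  \<open>block_sum\<close>.\<close>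

lemma sum_invariant_functions:
  assumes "finite X" "bij_betw \<sigma> X X"
  shows "(\<Sum>f | f \<in> X \<rightarrow>\<^sub>E {..<k} \<and> (\<forall>x\<in>X. f (\<sigma> x) = f x).
            F (map (\<lambda>i. card {x \<in> X. f x = i}) [0..<k])) = block_sum \<sigma> k X F"
  using assms
proof (induction k arbitrary: X F)
  case 0
  show ?case
  proof (cases "X = {}")
    case True
    hence "{f. f \<in> X \<rightarrow>\<^sub>E {..<0::nat} \<and> (\<forall>x\<in>X. f (\<sigma> x) = f x)} = {\<lambda>x. undefined}"
      by auto
    thus ?thesis using True by simp
  next
    case False
    hence "{f. f \<in> X \<rightarrow>\<^sub>E {..<0::nat} \<and> (\<forall>x\<in>X. f (\<sigma> x) = f x)} = {}"
      by (auto simp: PiE_eq_empty_iff)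
    thus ?thesis using False by (simp only: sum.empty) simp
  qed
next
  case (Suc k)
  have im: "\<sigma> ` X = X" and inj: "inj_on \<sigma> X" using Suc.prems by (auto simp: bij_betw_def)
  let ?S = "\<lambda>X k. {f. f \<in> X \<rightarrow>\<^sub>E {..<k::nat} \<and> (\<forall>x\<in>X. f (\<sigma> x) = f x)}"
  let ?G = "\<lambda>X f k. map (\<lambda>i. card {x \<in> X. f x = i}) [0..<k]"
  have fin: "finite (?S Y k)" if "finite Y" for Y k
    by (rule finite_subset[of _ "Y \<rightarrow>\<^sub>E {..<k}"]) (use that in \<open>auto intro: finite_PiE\<close>)
  have "block_sum \<sigma> (Suc k) X F = (\<Sum>A\<in>inv_subsets \<sigma> X. \<Sum>f\<in>?S (X - A) k. F (card A # ?G (X - A) f k))"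
  proof -
    have "(\<Sum>f\<in>?S (X - A) k. F (card A # ?G (X - A) f k))
        = block_sum \<sigma> k (X - A) (\<lambda>ms. F (card A # ms))" if "A \<in> inv_subsets \<sigma> X" for A
      by (rule Suc.IH) (use Suc.prems inv_subsets_diff[OF that] in auto)
    thus ?thesis by simp
  qed
  also have "\<dots> = (\<Sum>(A, f)\<in>Sigma (inv_subsets \<sigma> X) (\<lambda>A. ?S (X - A) k). F (card A # ?G (X - A) f k))"
    by (rule sum.Sigma) (use Suc.prems finite_inv_subsets fin in auto)
  also have "\<dots> = (\<Sum>f\<in>?S X (Suc k). F (?G X f (Suc k)))"
  proof (rule sum.reindex_bij_witness[of _
        "\<lambda>f. ({x \<in> X. f x = 0}, restrict (\<lambda>x. f x - 1) (X - {x \<in> X. f x = 0}))"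
        "\<lambda>(A, f). restrict (\<lambda>x. if x \<in> A then 0 else Suc (f x)) X"])
    fix p assume "p \<in> Sigma (inv_subsets \<sigma> X) (\<lambda>A. ?S (X - A) k)"
    then obtain A f where p: "p = (A, f)" and A: "A \<in> inv_subsets \<sigma> X" and f: "f \<in> ?S (X - A) k"
      by auto
    have AX: "A \<subseteq> X" and sA: "\<sigma> ` A = A" using A by (auto simp: inv_subsets_def)
    have sXA: "\<sigma> ` (X - A) = X - A" by (rule image_diff_inv[OF im sA AX inj])
    let ?f = "restrict (\<lambda>x. if x \<in> A then 0 else Suc (f x)) X"
    have z: "{x \<in> X. ?f x = 0} = A" using AX by auto
    show "(\<lambda>f. ({x \<in> X. f x = 0}, restrict (\<lambda>x. f x - 1) (X - {x \<in> X. f x = 0})))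
        ((\<lambda>(A, f). restrict (\<lambda>x. if x \<in> A then 0 else Suc (f x)) X) p) = p"
      using f unfolding p prod.case z by (auto simp: fun_eq_iff PiE_def extensional_def)
    have "?f (\<sigma> x) = ?f x" if "x \<in> X" for x
    proof (cases "x \<in> A")
      case True
      thus ?thesis using sA AX by (auto simp: image_iff)
    next
      case False
      hence "\<sigma> x \<in> X - A" using sXA that by auto
      thus ?thesis using f that False by auto
    qed
    moreover have "?f \<in> X \<rightarrow>\<^sub>E {..<Suc k}" using f by (auto simp: PiE_def Pi_def)
    ultimately show "(\<lambda>(A, f). restrict (\<lambda>x. if x \<in> A then 0 else Suc (f x)) X) p \<in> ?S X (Suc k)"
      unfolding p by simp
    have "{x \<in> X. ?f x = Suc i} = {x \<in> X - A. f x = i}" for i by auto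
    hence "?G X ?f (Suc k) = card A # ?G (X - A) f k"
      unfolding upt_conv_Cons[OF zero_less_Suc] map_Suc_upt[symmetric]
      using z by (simp del: upt_Suc restrict_apply)
    thus "F (?G X ((\<lambda>(A, f). restrict (\<lambda>x. if x \<in> A then 0 else Suc (f x)) X) p) (Suc k))
        = (case p of (A, f) \<Rightarrow> F (card A # ?G (X - A) f k))"
      unfolding p by simp
  next
    fix f assume f: "f \<in> ?S X (Suc k)"
    let ?A = "{x \<in> X. f x = 0}"
    \<comment> \<open>Invariance only sends the fibre into itself; equality follows since \<sigma>
      is injective and the fibre finite.\<close>
    have "\<sigma> ` ?A \<subseteq> ?A" using f im by auto
    hence sA: "\<sigma> ` ?A = ?A"
      by (intro card_subset_eq)
        (use Suc.prems inj_on_subset[OF inj, of ?A] in \<open>auto simp: card_image\<close>)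
    have sXA: "\<sigma> ` (X - ?A) = X - ?A" by (rule image_diff_inv[OF im sA _ inj]) auto
    show "(\<lambda>(A, f). restrict (\<lambda>x. if x \<in> A then 0 else Suc (f x)) X)
       (?A, restrict (\<lambda>x. f x - 1) (X - ?A)) = f"
      using f by (fastforce simp: fun_eq_iff PiE_def extensional_def)
    have "?A \<in> inv_subsets \<sigma> X" using sA by (auto simp: inv_subsets_def)
    moreover have "restrict (\<lambda>x. f x - 1) (X - ?A) \<in> (X - ?A) \<rightarrow>\<^sub>E {..<k}"
    proof (rule PiE_I)
      fix x assume x: "x \<in> X - ?A"
      hence "f x < Suc k" using f by auto
      thus "restrict (\<lambda>x. f x - 1) (X - ?A) x \<in> {..<k}" using x by auto
    qed auto
    moreover have "restrict (\<lambda>x. f x - 1) (X - ?A) (\<sigma> x) = restrict (\<lambda>x. f x - 1) (X - ?A) x"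
      if "x \<in> X - ?A" for x
    proof -
      have "\<sigma> x \<in> X - ?A" using sXA that by blast
      thus ?thesis using that f by simp
    qed
    ultimately show "(?A, restrict (\<lambda>x. f x - 1) (X - ?A))
        \<in> Sigma (inv_subsets \<sigma> X) (\<lambda>A. ?S (X - A) k)" by blast
  qed
  finally show ?case by simp
qed

text \<open>Exchanging the sum over \<open>\<pi>\<close> with the count of invariant functions
  attaches to each function a determinant with entries 0 and 1 that depends only on the fibre sizes.
  Summing these determinants is a \<open>block_sum\<close> of \<open>hook_det 1\<close>.\<close>

lemma sym_char_column:
  assumes "finite X" "bij_betw \<sigma> X X" "card X = k"
  shows "sym_char (col_part k) X \<sigma> = sign_on X \<sigma>"
proof (cases k)
  case 0
  thus ?thesis using assms
    by (simp add: sym_char_def col_part_def young_perm_char_def)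
next
  case (Suc l)
  let ?S = "{f. f \<in> X \<rightarrow>\<^sub>E {..<k::nat} \<and> (\<forall>x\<in>X. f (\<sigma> x) = f x)}"
  let ?m = "\<lambda>f i. card {x \<in> X. f x = i}"
  have finS: "finite ?S"
    by (rule finite_subset[of _ "X \<rightarrow>\<^sub>E {..<k}"]) (use assms in \<open>auto intro: finite_PiE\<close>)
  \<comment> \<open>The prescribed size 1 - i + \<pi>(i) may be negative. Moving i to the other side
    gives an equation in the naturals which then has no solution, as the convention for negative
    entries demands.\<close>
  have y: "young_perm_char X \<sigma> (map (\<lambda>i. int (col_part k ! i) - int i + int (\<pi> i)) [0..<length (col_part k)])
     = (\<Sum>f\<in>?S. \<Prod>i<k. of_bool (?m f i + i = 1 + \<pi> i))" for \<pi>
  proof -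
    have "young_perm_char X \<sigma> (map (\<lambda>i. int (col_part k ! i) - int i + int (\<pi> i)) [0..<length (col_part k)])
      = int (card {f \<in> ?S. \<forall>i<k. ?m f i + i = 1 + \<pi> i})"
      unfolding young_perm_char_def
      by (intro arg_cong[of _ _ int] arg_cong[of _ _ card]) (auto simp: col_part_def)
    also have "\<dots> = (\<Sum>f\<in>?S. of_bool (\<forall>i<k. ?m f i + i = 1 + \<pi> i))"
      using finS by (simp add: sum.If_cases of_bool_def Int_def)
    also have "\<dots> = (\<Sum>f\<in>?S. \<Prod>i<k. of_bool (?m f i + i = 1 + \<pi> i))"
      by (intro sum.cong) (auto simp: of_bool_def intro!: prod.neutral)
    finally show ?thesis .
  qed
  have "sym_char (col_part k) X \<sigma>
     = (\<Sum>\<pi> | \<pi> permutes {..<k}. sign \<pi> * (\<Sum>f\<in>?S. \<Prod>i<k. of_bool (?m f i + i = 1 + \<pi> i)))"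
    unfolding sym_char_def y by (simp add: col_part_def)
  also have "\<dots> = (\<Sum>f\<in>?S. \<Sum>\<pi> | \<pi> permutes {..<k}. sign \<pi> * (\<Prod>i<k. of_bool (?m f i + i = 1 + \<pi> i)))"
    unfolding sum_distrib_left by (rule sum.swap)
  also have "\<dots> = (\<Sum>f\<in>?S. hook_det 1 (map (?m f) [0..<k]))"
  proof (rule sum.cong[OF refl])
    fix f
    let ?M = "mat k k (\<lambda>(i, j). of_bool (if i = 0 then map (?m f) [0..<k] ! 0 = 1 + j
              else map (?m f) [0..<k] ! i + i = 1 + j)) :: int mat"
    have "hook_det 1 (map (?m f) [0..<k]) = det ?M" by (simp add: hook_det_def del: One_nat_def)
    also have "\<dots> = (\<Sum>\<pi> | \<pi> permutes {..<k}. sign \<pi> * (\<Prod>i<k. ?M $$ (i, \<pi> i)))"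
      by (subst det_def'[of _ k]) (simp_all add: atLeast0LessThan)
    also have "\<dots> = (\<Sum>\<pi> | \<pi> permutes {..<k}. sign \<pi> * (\<Prod>i<k. of_bool (?m f i + i = 1 + \<pi> i)))"
    proof (intro sum.cong prod.cong refl arg_cong2[of _ _ _ _ "(*)"])
      fix \<pi> i assume "\<pi> \<in> {\<pi>. \<pi> permutes {..<k}}" "i \<in> {..<k}"
      moreover from this have "\<pi> i < k" using permutes_in_image[of \<pi> "{..<k}" i] by simp
      ultimately show "?M $$ (i, \<pi> i) = of_bool (?m f i + i = 1 + \<pi> i)" by auto
    qed
    finally show "(\<Sum>\<pi> | \<pi> permutes {..<k}. sign \<pi> * (\<Prod>i<k. of_bool (?m f i + i = 1 + \<pi> i)))
       = hook_det 1 (map (?m f) [0..<k])" by simp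
  qed
  also have "\<dots> = block_sum \<sigma> (Suc l) X (hook_det 1)"
    unfolding Suc by (rule sum_invariant_functions[OF assms(1,2)])
  also have "\<dots> = (\<Sum>A | A \<in> inv_subsets \<sigma> X \<and> 1 \<le> card A. (-1) ^ (card A - 1) * sign_on (X - A) \<sigma>)"
    by (rule block_sum_hook_det) (use assms Suc in auto)
  also have "\<dots> = sign_on X \<sigma>"
    by (rule sum_nonempty_inv_subsets) (use assms Suc in auto)
  finally show ?thesis .
qed

lemma sym_char_row:
  assumes "finite X" "\<sigma> ` X \<subseteq> X" "card X = k"
  shows "sym_char (row_part k) X \<sigma> = 1"
proof (cases "k = 0")
  case True
  thus ?thesis using assms
    by (simp add: sym_char_def row_part_def young_perm_char_def)
next
  case False
  have "{f \<in> X \<rightarrow>\<^sub>E {..<Suc 0}. (int (card {x \<in> X. f x = 0}) = int k) \<and> (\<forall>x\<in>X. f (\<sigma> x) = f x)}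
     = {restrict (\<lambda>_. 0) X}"
  proof (intro equalityI subsetI, goal_cases)
    case (1 f)
    thus ?case by (auto simp: fun_eq_iff PiE_def extensional_def)
  next
    case (2 f)
    hence [simp]: "f = restrict (\<lambda>_. 0) X" by simp
    have "{x \<in> X. f x = 0} = X" by auto
    thus ?case using assms by auto
  qed
  moreover have "{p. p permutes {..<Suc 0}} = {id}"
    by (auto simp: lessThan_Suc permutes_sing)
  ultimately show ?thesis using False
    by (simp add: sym_char_def row_part_def young_perm_char_def)
qed

section \<open>The Grassmann algebra\<close>

lemma grass_sign_Un:
  assumes "finite A" "finite B" "finite C" "B \<inter> C = {}"
  shows "(grass_sign A (B \<union> C) :: 'a::field) = grass_sign A B * grass_sign A C"
proof -
  have "{(x, y). x \<in> A \<and> y \<in> B \<union> C \<and> y < x}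
     = {(x, y). x \<in> A \<and> y \<in> B \<and> y < x} \<union> {(x, y). x \<in> A \<and> y \<in> C \<and> y < x}" by auto
  moreover have "finite {(x, y). x \<in> A \<and> y \<in> B \<and> y < x}"
    by (rule finite_subset[of _ "A \<times> B"]) (use assms in auto)
  moreover have "finite {(x, y). x \<in> A \<and> y \<in> C \<and> y < x}"
    by (rule finite_subset[of _ "A \<times> C"]) (use assms in auto)
  moreover have "{(x, y). x \<in> A \<and> y \<in> B \<and> y < x} \<inter> {(x, y). x \<in> A \<and> y \<in> C \<and> y < x} = {}"
    using assms by auto
  ultimately show ?thesis by (simp add: grass_sign_def card_Un_disjoint power_add)
qed

text \<open>Since \<open>A\<close> and \<open>B\<close> are disjoint, each pair in
  \<open>A \<times> B\<close> is an inversion in exactly one of the two orders, so the two inversion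
  counts add up to \<open>card A * card B\<close>.\<close>

lemma grass_sign_swap:
  assumes "finite A" "finite B" "A \<inter> B = {}"
  shows "(grass_sign A B :: 'a::field) = (-1) ^ (card A * card B) * grass_sign B A"
proof -
  let ?P = "{(x, y). x \<in> A \<and> y \<in> B \<and> y < x}" and ?Q = "{(x, y). x \<in> B \<and> y \<in> A \<and> y < x}"
  have fin: "finite ?P" "finite ?Q"
    by (rule finite_subset[of _ "A \<times> B"], use assms in auto)
       (rule finite_subset[of _ "B \<times> A"], use assms in auto)
  have "A \<times> B = ?P \<union> prod.swap ` ?Q"
  proof (intro equalityI subsetI, goal_cases)
    case (1 p)
    then obtain x y where p: "p = (x, y)" "x \<in> A" "y \<in> B" by auto
    hence "x \<noteq> y" using assms(3) by auto
    hence "y < x \<or> x < y" by auto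
    thus ?case using p by (auto intro!: image_eqI[of "(x, y)" prod.swap "(y, x)"])
  qed auto
  moreover have "?P \<inter> prod.swap ` ?Q = {}" by auto
  ultimately have "card A * card B = card ?P + card ?Q"
    using fin card_cartesian_product[of A B]
    by (simp add: card_Un_disjoint card_image[OF inj_on_subset[OF inj_swap subset_UNIV]])
  hence "(-1 :: 'a) ^ (card A * card B) * (-1) ^ card ?Q = (-1) ^ card ?P * ((-1) ^ card ?Q * (-1) ^ card ?Q)"
    by (simp add: power_add)
  also have "(-1 :: 'a) ^ card ?Q * (-1) ^ card ?Q = 1"
    by (simp flip: power_add mult_2)
  finally show ?thesis by (simp add: grass_sign_def)
qed

text \<open>The third index set is forced to be \<open>C - A - B\<close>, and the summand is
  symmetric in the pairs (\<open>u\<close>, \<open>A\<close>) and (\<open>v\<close>,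
  \<open>B\<close>) except for the leading \<open>grass_sign A B\<close>. This form takes the place
  of associativity when neighbouring factors are exchanged.\<close>

lemma grass_mult_mult:
  fixes u v x :: "'a::field grass"
  assumes "finite C"
  shows "grass_mult u (grass_mult v x) C =
    (\<Sum>(A, B) | A \<subseteq> C \<and> B \<subseteq> C \<and> A \<inter> B = {}.
       grass_sign A B * (grass_sign A (C - A - B) * grass_sign B (C - A - B) * (u A * v B * x (C - A - B))))"
proof -
  have fin: "finite A" if "A \<subseteq> C" for A using that assms by (rule finite_subset)
  have "grass_mult u (grass_mult v x) C = (\<Sum>A\<in>Pow C. \<Sum>B\<in>Pow (C - A).
     grass_sign A (C - A) * u A * (grass_sign B (C - A - B) * v B * x (C - A - B)))"
    using assms by (simp add: grass_mult_def sum_distrib_left)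
  also have "\<dots> = (\<Sum>A\<in>Pow C. \<Sum>B\<in>Pow (C - A).
      grass_sign A B * (grass_sign A (C - A - B) * grass_sign B (C - A - B) * (u A * v B * x (C - A - B))))"
  proof (intro sum.cong refl)
    fix A B assume A: "A \<in> Pow C" "B \<in> Pow (C - A)"
    hence eq: "B \<union> (C - A - B) = C - A" by auto
    have "finite A" "finite B" "finite (C - A - B)" using A by (auto intro!: fin)
    hence "grass_sign A (C - A) = (grass_sign A B * grass_sign A (C - A - B) :: 'a)"
      using grass_sign_Un[of A B "C - A - B"] unfolding eq by blast
    thus "grass_sign A (C - A) * u A * (grass_sign B (C - A - B) * v B * x (C - A - B))
      = grass_sign A B * (grass_sign A (C - A - B) * grass_sign B (C - A - B) * (u A * v B * x (C - A - B)))"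
      by (simp add: ac_simps)
  qed
  also have "\<dots> = (\<Sum>(A, B)\<in>Sigma (Pow C) (\<lambda>A. Pow (C - A)).
      grass_sign A B * (grass_sign A (C - A - B) * grass_sign B (C - A - B) * (u A * v B * x (C - A - B))))"
    by (rule sum.Sigma) (use assms in auto)
  also have "Sigma (Pow C) (\<lambda>A. Pow (C - A)) = {(A, B). A \<subseteq> C \<and> B \<subseteq> C \<and> A \<inter> B = {}}" by auto
  finally show ?thesis .
qed

text \<open>The scalar \<open>c\<close> is 1 when a factor is even and -1 when both are odd. The
  tail \<open>x\<close> is present because products are nested to the right, so this is precisely an
  exchange of two neighbouring letters of a word.\<close>

lemma grass_mult_left_commute:
  fixes u v x :: "'a::field grass"
  assumes "\<And>A B. u A \<noteq> 0 \<Longrightarrow> v B \<noteq> 0 \<Longrightarrow> (-1) ^ (card A * card B) = c"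
  shows "grass_mult u (grass_mult v x) = (\<lambda>C. c * grass_mult v (grass_mult u x) C)"
proof
  fix C
  show "grass_mult u (grass_mult v x) C = c * grass_mult v (grass_mult u x) C"
  proof (cases "finite C")
    case True
    let ?t = "\<lambda>(u :: 'a grass) v A B. grass_sign A B * (grass_sign A (C - A - B) * grass_sign B (C - A - B)
        * (u A * v B * x (C - A - B)))"
    show ?thesis unfolding grass_mult_mult[OF True] sum_distrib_left
    proof (rule sum.reindex_bij_witness[of _ prod.swap prod.swap])
      fix p assume "p \<in> {(A, B). A \<subseteq> C \<and> B \<subseteq> C \<and> A \<inter> B = {}}"
      then obtain A B where p: "p = (A, B)" "A \<subseteq> C" "B \<subseteq> C" "A \<inter> B = {}" by auto
      have D: "C - B - A = C - A - B" by auto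
      have "c * ?t v u B A = ?t u v A B"
      proof (cases "u A = 0 \<or> v B = 0")
        case False
        hence "c = (-1) ^ (card A * card B)" using assms[of A B] by simp
        moreover have "(grass_sign A B :: 'a) = (-1) ^ (card A * card B) * grass_sign B A"
          by (rule grass_sign_swap) (use p finite_subset[OF _ True] in auto)
        ultimately show ?thesis by (simp add: D ac_simps)
      qed auto
      thus "c * (case prod.swap p of (A, B) \<Rightarrow> ?t v u A B) = (case p of (A, B) \<Rightarrow> ?t u v A B)"
        by (simp add: p)
    qed auto
  qed (simp add: grass_mult_def)
qed

lemma grass_mult_even_commute:
  fixes u v :: "'a::field grass"
  assumes "\<And>A. u A \<noteq> 0 \<Longrightarrow> even (card A)"
  shows "grass_mult u v = grass_mult v u"
proof
  fix C
  show "grass_mult u v C = grass_mult v u C"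
  proof (cases "finite C")
    case True
    have "(\<Sum>A\<in>Pow C. grass_sign A (C - A) * u A * v (C - A))
        = (\<Sum>A\<in>Pow C. grass_sign A (C - A) * v A * u (C - A))"
    proof (rule sum.reindex_bij_witness[of _ "\<lambda>A. C - A" "\<lambda>A. C - A"])
      fix A assume A: "A \<in> Pow C"
      hence D: "C - (C - A) = A" by auto
      show "grass_sign (C - A) (C - (C - A)) * v (C - A) * u (C - (C - A))
          = grass_sign A (C - A) * u A * v (C - A)"
      proof (cases "u A = 0")
        case False
        have "(grass_sign A (C - A) :: 'a) = (-1) ^ (card A * card (C - A)) * grass_sign (C - A) A"
          by (rule grass_sign_swap) (use A finite_subset[OF _ True] in auto)
        thus ?thesis using assms[OF False] by (simp add: D ac_simps)
      qed (simp add: D)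
    qed auto
    thus ?thesis using True by (simp add: grass_mult_def)
  qed (simp add: grass_mult_def)
qed

lemma grass_mult_nonzeroE:
  fixes u v :: "'a::field grass"
  assumes "grass_mult u v C \<noteq> 0"
  obtains A where "finite C" "A \<subseteq> C" "u A \<noteq> 0" "v (C - A) \<noteq> 0"
proof -
  have C: "finite C" using assms by (auto simp: grass_mult_def split: if_splits)
  hence "(\<Sum>A\<in>Pow C. grass_sign A (C - A) * u A * v (C - A)) \<noteq> 0"
    using assms by (simp add: grass_mult_def)
  then obtain A where "A \<in> Pow C" "grass_sign A (C - A) * u A * v (C - A) \<noteq> 0"
    by (rule sum.not_neutral_contains_not_neutral)
  thus ?thesis using that C by auto
qed

lemma grass_mult_carrier:
  assumes "u \<in> grass_carrier" "v \<in> grass_carrier"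
  shows "grass_mult u v \<in> (grass_carrier :: 'a::field grass set)"
proof -
  have "{C. grass_mult u v C \<noteq> 0} \<subseteq> (\<lambda>(A, B). A \<union> B) ` ({A. u A \<noteq> 0} \<times> {B. v B \<noteq> 0})"
  proof
    fix C assume "C \<in> {C. grass_mult u v C \<noteq> 0}"
    then obtain A where "A \<subseteq> C" "u A \<noteq> 0" "v (C - A) \<noteq> 0"
      by (metis (mono_tags, lifting) grass_mult_nonzeroE mem_Collect_eq)
    thus "C \<in> (\<lambda>(A, B). A \<union> B) ` ({A. u A \<noteq> 0} \<times> {B. v B \<noteq> 0})"
      by (intro image_eqI[of _ _ "(A, C - A)"]) auto
  qed
  hence "finite {C. grass_mult u v C \<noteq> 0}"
    by (rule finite_subset, intro finite_imageI finite_cartesian_product)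
      (use assms in \<open>simp_all add: grass_carrier_def\<close>)
  moreover have "finite C" if "grass_mult u v C \<noteq> 0" for C
    using that by (rule grass_mult_nonzeroE)
  ultimately show ?thesis unfolding grass_carrier_def by blast
qed

section \<open>Basis elements and the center\<close>

definition grass_basis :: "nat set \<Rightarrow> 'a::field grass" where
  "grass_basis T = (\<lambda>A. if A = T then 1 else 0)"

lemma grass_basis_eq_0_iff [simp]: "grass_basis T A = 0 \<longleftrightarrow> A \<noteq> T"
  by (simp add: grass_basis_def)

lemma grass_one_eq_basis: "grass_one = grass_basis {}"
  by (simp add: grass_one_def grass_basis_def)

lemma grass_basis_carrier: "finite T \<Longrightarrow> grass_basis T \<in> (grass_carrier :: 'a::field grass set)"
  by (simp add: grass_carrier_def)

lemma grass_basis_even: "finite T \<Longrightarrow> even (card T) \<Longrightarrow> grass_basis T \<in> (grass_even :: 'a::field grass set)"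
  by (simp add: grass_even_def grass_basis_carrier)

lemma grass_basis_odd: "finite T \<Longrightarrow> odd (card T) \<Longrightarrow> grass_basis T \<in> (grass_odd :: 'a::field grass set)"
  by (simp add: grass_odd_def grass_basis_carrier)

lemma grass_mult_basis_left:
  assumes "finite C"
  shows "grass_mult (grass_basis T) (x :: 'a::field grass) C
    = (if T \<subseteq> C then grass_sign T (C - T) * x (C - T) else 0)"
proof -
  have "(\<Sum>A\<in>Pow C. grass_sign A (C - A) * grass_basis T A * x (C - A))
     = (\<Sum>A\<in>Pow C. if A = T then grass_sign T (C - T) * x (C - T) else 0)"
    by (intro sum.cong) (auto simp: grass_basis_def)
  thus ?thesis using assms by (simp add: grass_mult_def)
qed

lemma grass_even_center: "u \<in> grass_even \<Longrightarrow> u \<in> (grass_center :: 'a::field grass set)"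
  using grass_mult_even_commute[of u] by (auto simp: grass_even_def grass_center_def)

text \<open>The generator \<open>e\<^sub>0\<close> anticommutes with every odd \<open>e\<^sub>T\<close> not involving it, and \<open>2 \<noteq> 0\<close>.\<close>

lemma odd_basis_not_central:
  fixes c :: "'a::field_char_0"
  assumes "(\<lambda>C. c * grass_basis T C) \<in> grass_center" "finite T" "odd (card T)" "0 \<notin> T"
  shows "c = 0"
proof -
  let ?u = "\<lambda>C. c * grass_basis T C" and ?e = "grass_basis {0} :: 'a grass"
  have fin: "finite (insert 0 T)" using assms by auto
  have [simp]: "insert 0 T - T = {0}" "insert 0 T - {0} = T" using assms(4) by auto
  have "?e \<in> grass_carrier" by (rule grass_basis_carrier) simp
  moreover have "\<forall>v\<in>grass_carrier. grass_mult ?u v = grass_mult v ?u"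
    using assms(1) unfolding grass_center_def by blast
  ultimately have "grass_mult ?u ?e = grass_mult ?e ?u" by blast
  \<comment> \<open>At \<open>insert 0 T\<close> each side reduces to a single term,
    \<open>c\<close> times a sign, and the two signs are opposite because \<open>card T\<close> is
    odd.\<close>
  hence "grass_mult ?u ?e (insert 0 T) = grass_mult ?e ?u (insert 0 T)" by (rule fun_cong)
  moreover have "grass_mult ?e ?u (insert 0 T) = grass_sign {0} T * c"
    unfolding grass_mult_basis_left[OF fin] by (simp add: grass_basis_def)
  moreover have "grass_mult ?u ?e (insert 0 T) = c * grass_mult (grass_basis T) ?e (insert 0 T)"
    using fin by (simp add: grass_mult_def sum_distrib_left ac_simps)
  moreover have "grass_mult (grass_basis T) ?e (insert 0 T) = grass_sign T {0}"
    unfolding grass_mult_basis_left[OF fin] by (simp add: grass_basis_def subset_insertI)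
  moreover have "(grass_sign T {0} :: 'a) = - grass_sign {0} T"
    using grass_sign_swap[of T "{0}"] assms by auto
  moreover have "(grass_sign {0} T :: 'a) \<noteq> 0" by (simp add: grass_sign_def)
  ultimately show "c = 0" by simp
qed

section \<open>Signs of arrangements\<close>

lemma exists_permutes_map_eq:
  assumes "distinct l" "distinct l'" "set l = set l'"
  obtains p where "p permutes set l" "map p l = l'"
proof -
  have len: "length l = length l'" using assms by (metis distinct_card)
  define f where "f = (!) l' \<circ> inv_into {..<length l} ((!) l)"
  have b: "bij_betw ((!) l) {..<length l} (set l)" by (rule bij_betw_nth[OF assms(1)]) auto
  have b': "bij_betw ((!) l') {..<length l} (set l)"
    using assms(3) len by (intro bij_betw_nth[OF assms(2)]) auto
  have "bij_betw f (set l) (set l)"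
    unfolding f_def by (rule bij_betw_trans[OF bij_betw_inv_into[OF b] b'])
  hence "restrict_id f (set l) permutes set l" by (rule permutes_restrict_id)
  moreover have "map (restrict_id f (set l)) l = l'"
  proof (rule nth_equalityI)
    fix i assume "i < length (map (restrict_id f (set l)) l)"
    hence i: "i < length l" by simp
    hence "inv_into {..<length l} ((!) l) (l ! i) = i"
      using bij_betw_inv_into_left[OF b, of i] by simp
    thus "map (restrict_id f (set l)) l ! i = l' ! i" using i by (simp add: f_def)
  qed (simp add: len)
  ultimately show ?thesis by (rule that)
qed

text \<open>For a distinct list this is the sign of its arrangement relative to increasing order.
  The permutation acts on entries rather than on positions, so renaming the entries composes on the
  left and multiplies the sign.\<close>

definition list_sign :: "nat list \<Rightarrow> int" where
  "list_sign l = sign (SOME p. p permutes set l \<and> map p (sorted_list_of_set (set l)) = l)"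

lemma list_sign_eqI:
  assumes "p permutes set l" "map p (sorted_list_of_set (set l)) = l"
  shows "list_sign l = sign p"
proof -
  have uniq: "q = p" if q: "q permutes set l" "map q (sorted_list_of_set (set l)) = l" for q
  proof
    fix x
    have "map q (sorted_list_of_set (set l)) = map p (sorted_list_of_set (set l))"
      using q(2) assms(2) by simp
    hence "x \<in> set l \<Longrightarrow> q x = p x" by (simp only: map_eq_conv) simp
    moreover have "x \<notin> set l \<Longrightarrow> q x = p x" using q(1) assms(1) by (simp add: permutes_not_in)
    ultimately show "q x = p x" by blast
  qed
  have "(SOME p. p permutes set l \<and> map p (sorted_list_of_set (set l)) = l) = p"
    by (rule some_equality, intro conjI assms, elim conjE, rule uniq)
  thus ?thesis by (simp add: list_sign_def)
qed

lemma list_sign_sorted_list_of_set: "finite T \<Longrightarrow> list_sign (sorted_list_of_set T) = 1"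
  using list_sign_eqI[of id "sorted_list_of_set T"] by simp

lemma list_sign_map:
  assumes "distinct l" "p permutes set l"
  shows "list_sign (map p l) = sign p * list_sign l"
proof -
  obtain q where q: "q permutes set l" "map q (sorted_list_of_set (set l)) = l"
    using exists_permutes_map_eq[of "sorted_list_of_set (set l)" l] assms(1) by auto
  have s: "set (map p l) = set l" using permutes_image[OF assms(2)] by simp
  have "list_sign (map p l) = sign (p \<circ> q)"
  proof (rule list_sign_eqI)
    show "p \<circ> q permutes set (map p l)" unfolding s by (rule permutes_compose[OF q(1) assms(2)])
    show "map (p \<circ> q) (sorted_list_of_set (set (map p l))) = map p l"
      unfolding s map_map[symmetric] q(2) ..
  qed
  also have "\<dots> = sign p * sign q"
    by (intro sign_compose permutes_imp_permutation[of "set l"] assms(2) q(1)) auto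
  finally show ?thesis using list_sign_eqI[OF q] by simp
qed

lemma list_sign_square: "distinct l \<Longrightarrow> list_sign l * list_sign l = 1"
  by (simp add: list_sign_def)

lemma list_sign_swap:
  assumes "distinct (xs @ a # b # ys)"
  shows "list_sign (xs @ b # a # ys) = - list_sign (xs @ a # b # ys)"
proof -
  have "map (transpose a b) (xs @ a # b # ys) = xs @ b # a # ys"
    using assms by (auto intro!: map_idI transpose_apply_other)
  moreover have "transpose a b permutes set (xs @ a # b # ys)"
    by (rule permutes_swap_id) auto
  ultimately show ?thesis
    using list_sign_map[OF assms, of "transpose a b"] assms by (simp add: sign_swap_id)
qed

lemma list_sign_map_sign_on:
  assumes "distinct l" "bij_betw \<sigma> (set l) (set l)"
  shows "list_sign (map \<sigma> l) = sign_on (set l) \<sigma> * list_sign l"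
proof -
  have "map \<sigma> l = map (restrict_id \<sigma> (set l)) l" by simp
  thus ?thesis
    using list_sign_map[OF assms(1) permutes_restrict_id[OF assms(2)]] by (simp only: sign_on_def)
qed

text \<open>If \<open>p\<close> takes \<open>l\<close> to \<open>l'\<close>, then the conjugate of
  \<open>p\<close> by \<sigma> takes the renamed \<open>l\<close> to the renamed \<open>l'\<close>,
  and conjugation preserves signs. So the sign change caused by renaming depends only on the set of
  entries, even when \<sigma> moves that set elsewhere.\<close>

lemma list_sign_map_ratio:
  assumes "distinct l" "distinct l'" "set l = set l'" "\<sigma> permutes S" "finite S"
  shows "list_sign (map \<sigma> l') = list_sign (map \<sigma> l) * list_sign l * list_sign l'"
proof -
  obtain p where p: "p permutes set l" "map p l = l'"
    using exists_permutes_map_eq assms(1-3) by blast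
  let ?i = "inv_into UNIV \<sigma>"
  have bij: "bij \<sigma>" by (rule permutes_bij[OF assms(4)])
  have perm: "permutation p" "permutation \<sigma>" "permutation ?i"
    using p(1) assms permutes_imp_permutation permutation_inverse by auto
  have i: "?i (\<sigma> x) = x" for x using bij by (simp add: bij_is_inj inv_f_f)
  have i': "\<sigma> (?i x) = x" for x using bij by (simp add: bij_is_surj surj_f_inv_f)
  let ?c = "\<sigma> \<circ> p \<circ> ?i"
  have c: "?c permutes set (map \<sigma> l)"
  proof (rule bij_imp_permutes)
    have "bij ?c" using bij permutes_bij[OF p(1)] by (intro bij_comp bij_imp_bij_inv)
    moreover have "?c ` set (map \<sigma> l) = \<sigma> ` (p ` set l)" by (simp add: image_image i)
    ultimately show "bij_betw ?c (set (map \<sigma> l)) (set (map \<sigma> l))"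
      using permutes_image[OF p(1)] by (auto simp: bij_betw_def intro: inj_on_subset)
    fix x assume "x \<notin> set (map \<sigma> l)"
    hence "?i x \<notin> set l" using i'[of x] by (auto simp: image_iff)
    thus "?c x = x" using permutes_not_in[OF p(1)] i' by simp
  qed
  have "map \<sigma> l' = map ?c (map \<sigma> l)" unfolding p(2)[symmetric] by (simp add: i)
  moreover have "distinct (map \<sigma> l)"
    using assms(1) bij by (simp add: distinct_map bij_is_inj inj_on_subset[OF _ subset_UNIV])
  ultimately have "list_sign (map \<sigma> l') = sign ?c * list_sign (map \<sigma> l)"
    using list_sign_map c by metis
  also have "sign ?c = sign p"
    using perm by (simp add: sign_compose permutation_compose sign_inverse)
  also have "sign p = list_sign l * list_sign l'"
    using list_sign_map[OF assms(1) p(1)] list_sign_square[OF assms(1)] by (simp add: p(2))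
  finally show ?thesis by simp
qed

text \<open>Bubble sort: the head of \<open>l\<close> is carried to the front of \<open>l'\<close>
  one neighbour at a time, and the tails are treated by induction with that head kept in front.
  Invariance is asked only for rearrangements of \<open>l\<close>, since the sign rule for words
  requires distinct letters.\<close>

lemma adjacent_swap_invariant:
  assumes "\<And>xs a b ys. mset (xs @ a # b # ys) = mset l \<Longrightarrow> \<Phi> (xs @ a # b # ys) = \<Phi> (xs @ b # a # ys)"
    and "mset l' = mset l"
  shows "\<Phi> l' = \<Phi> l"
  using assms
proof (induction l arbitrary: l' \<Phi>)
  case (Cons a l)
  have "a \<in> set l'" using Cons.prems(2) by (metis list.set_intros(1) set_mset_mset)
  then obtain xs ys where l': "l' = xs @ a # ys" by (meson split_list)
  have "mset (xs @ a # ys) = mset (a # l) \<Longrightarrow> \<Phi> (xs @ a # ys) = \<Phi> (a # xs @ ys)" for ys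
  proof (induction xs arbitrary: ys rule: rev_induct)
    case (snoc x xs)
    have "\<Phi> (xs @ x # a # ys) = \<Phi> (xs @ a # x # ys)"
      using snoc.prems by (intro Cons.prems(1)) simp
    also have "\<dots> = \<Phi> (a # xs @ x # ys)"
      by (rule snoc.IH) (use snoc.prems in simp)
    finally show ?case by simp
  qed simp
  hence "\<Phi> l' = \<Phi> (a # xs @ ys)" using Cons.prems(2) l' by simp
  also have "\<dots> = \<Phi> (a # l)"
  proof (rule Cons.IH[of "\<lambda>m. \<Phi> (a # m)"])
    fix us b c vs assume "mset (us @ b # c # vs) = mset l"
    thus "\<Phi> (a # us @ b # c # vs) = \<Phi> (a # us @ c # b # vs)"
      using Cons.prems(1)[of "a # us" b c vs] by simp
  qed (use Cons.prems(2) l' in simp)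
  finally show ?case .
qed simp

section \<open>Evaluating words\<close>

lemma grass_mult_scale_right:
  "grass_mult u (\<lambda>C. c * x C) = (\<lambda>C. c * grass_mult u (x :: 'a::field grass) C)"
  by (auto simp: grass_mult_def fun_eq_iff sum_distrib_left ac_simps)

lemma grass_mult_zero_left: "grass_mult (\<lambda>_. 0) x = (\<lambda>_. 0 :: 'a::field)"
  by (auto simp: grass_mult_def fun_eq_iff)

lemma grass_mult_zero_right: "grass_mult x (\<lambda>_. 0) = (\<lambda>_. 0 :: 'a::field)"
  by (auto simp: grass_mult_def fun_eq_iff)

lemma grass_prod_Nil [simp]: "grass_prod [] = grass_one"
  by (simp add: grass_prod_def)

lemma grass_prod_Cons [simp]: "grass_prod (u # us) = grass_mult u (grass_prod us)"
  by (simp add: grass_prod_def)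

lemma grass_prod_eq_zero: "(\<lambda>_. 0) \<in> set us \<Longrightarrow> grass_prod us = (\<lambda>_. 0 :: 'a::field)"
  by (induction us) (auto simp: grass_mult_zero_left grass_mult_zero_right)

lemma grass_mult_basis_basis:
  assumes "finite A" "finite S" "A \<inter> S = {}"
  shows "grass_mult (grass_basis A) (grass_basis S)
    = (\<lambda>C. grass_sign A S * (grass_basis (A \<union> S) C :: 'a::field))"
proof
  fix C
  show "grass_mult (grass_basis A) (grass_basis S) C = grass_sign A S * (grass_basis (A \<union> S) C :: 'a)"
  proof (cases "finite C")
    case True
    show ?thesis
    proof (cases "C = A \<union> S")
      case C: True
      have "(A \<union> S) - A = S" using assms(3) by auto
      thus ?thesis unfolding grass_mult_basis_left[OF True] by (simp add: C grass_basis_def)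
    next
      case False
      hence "A \<subseteq> C \<Longrightarrow> C - A \<noteq> S" by auto
      thus ?thesis unfolding grass_mult_basis_left[OF True] using False by (simp add: grass_basis_def)
    qed
  next
    case False
    hence "C \<noteq> A \<union> S" using assms by auto
    thus ?thesis using False by (simp add: grass_mult_def grass_basis_def)
  qed
qed

text \<open>Indices outside \<open>T\<close> contribute the unit, those in \<open>T\<close> their
  generators. The scalar is a product of reordering signs; later only its being nonzero
  matters.\<close>

lemma grass_prod_basis:
  assumes "distinct l"
  obtains c :: "'a::field" where "c \<noteq> 0"
    "grass_prod (map (\<lambda>i. grass_basis (if i \<in> T then {i} else {})) l)
       = (\<lambda>C. c * grass_basis (set l \<inter> T) C)"
  using assms
proof (induction l arbitrary: thesis)
  case Nil
  show ?case by (rule Nil(1)[of 1]) (auto simp: grass_one_eq_basis)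
next
  case (Cons i l)
  from Cons.prems(2) have "distinct l" "i \<notin> set l" by auto
  obtain c :: 'a where c: "c \<noteq> 0" "grass_prod (map (\<lambda>i. grass_basis (if i \<in> T then {i} else {})) l)
       = (\<lambda>C. c * grass_basis (set l \<inter> T) C)"
    using Cons.IH[OF _ \<open>distinct l\<close>] by blast
  let ?A = "if i \<in> T then {i} else {}"
  have A: "?A \<union> (set l \<inter> T) = set (i # l) \<inter> T" by auto
  have "grass_prod (map (\<lambda>i. grass_basis (if i \<in> T then {i} else {})) (i # l))
     = (\<lambda>C. c * grass_mult (grass_basis ?A) (grass_basis (set l \<inter> T)) C)"
    by (simp only: list.map grass_prod_Cons c(2) grass_mult_scale_right)
  also have "\<dots> = (\<lambda>C. c * grass_sign ?A (set l \<inter> T) * grass_basis (set (i # l) \<inter> T) C)"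
    using \<open>i \<notin> set l\<close> by (subst grass_mult_basis_basis) (auto simp: A mult.assoc)
  finally show ?case
    by (intro Cons.prems(1)[of "c * grass_sign ?A (set l \<inter> T)"]) (simp_all add: c(1) grass_sign_def)
qed

lemma grass_even_sum:
  assumes "finite S" "\<And>t. t \<in> S \<Longrightarrow> g t \<in> grass_even"
  shows "(\<lambda>C. \<Sum>t\<in>S. c t * g t C) \<in> (grass_even :: 'a::field grass set)"
proof -
  let ?h = "\<lambda>C. \<Sum>t\<in>S. c t * g t C"
  have nz: "\<exists>t\<in>S. g t C \<noteq> 0" if "?h C \<noteq> 0" for C
    using that by (metis (no_types, lifting) mult_zero_right sum.neutral)
  have "{C. ?h C \<noteq> 0} \<subseteq> (\<Union>t\<in>S. {C. g t C \<noteq> 0})" using nz by blast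
  moreover have "finite (\<Union>t\<in>S. {C. g t C \<noteq> 0})"
    using assms by (intro finite_UN_I) (auto simp: grass_even_def grass_carrier_def)
  ultimately have "finite {C. ?h C \<noteq> 0}" by (rule finite_subset)
  moreover have "finite C \<and> even (card C)" if C: "?h C \<noteq> 0" for C
  proof -
    obtain t where "t \<in> S" "g t C \<noteq> 0" using nz[OF C] by blast
    thus ?thesis using assms(2)[of t] unfolding grass_even_def grass_carrier_def by blast
  qed
  ultimately show ?thesis unfolding grass_even_def grass_carrier_def by blast
qed

section \<open>Words and the order of their odd letters\<close>

fun odd_indices :: "(nat + nat) list \<Rightarrow> nat list" where
  "odd_indices [] = []"
| "odd_indices (Inl i # w) = odd_indices w"
| "odd_indices (Inr i # w) = i # odd_indices w"

lemma odd_indices_append [simp]: "odd_indices (v @ w) = odd_indices v @ odd_indices w"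
  by (induction v rule: odd_indices.induct) auto

lemma set_odd_indices: "set (odd_indices w) = {i. Inr i \<in> set w}"
  by (induction w rule: odd_indices.induct) auto

lemma odd_indices_map_sum [simp]: "odd_indices (map (map_sum f g) w) = map g (odd_indices w)"
  by (induction w rule: odd_indices.induct) auto

lemma distinct_odd_indices: "distinct w \<Longrightarrow> distinct (odd_indices w)"
  by (induction w rule: odd_indices.induct) (auto simp: set_odd_indices)

definition word_eval :: "(nat \<Rightarrow> 'a::field grass) \<Rightarrow> (nat \<Rightarrow> 'a grass) \<Rightarrow> (nat + nat) list \<Rightarrow> 'a grass" where
  "word_eval ys zs w = grass_prod (map (\<lambda>l. case l of Inl i \<Rightarrow> ys i | Inr i \<Rightarrow> zs i) w)"

lemma word_eval_Nil [simp]: "word_eval ys zs [] = grass_one"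
  by (simp add: word_eval_def)

lemma word_eval_Cons [simp]:
  "word_eval ys zs (l # w) = grass_mult (case l of Inl i \<Rightarrow> ys i | Inr i \<Rightarrow> zs i) (word_eval ys zs w)"
  by (simp add: word_eval_def)

lemma word_eval_swap:
  fixes ys zs :: "nat \<Rightarrow> 'a::field grass"
  assumes "graded_eval_ok ys zs"
  shows "word_eval ys zs (us @ a # b # vs)
     = (\<lambda>C. (if isl a \<or> isl b then 1 else - 1) * word_eval ys zs (us @ b # a # vs) C)"
proof (induction us)
  case Nil
  have y: "even (card A)" if "ys i A \<noteq> 0" for i A
    using assms that by (auto simp: graded_eval_ok_def grass_even_def)
  have z: "odd (card A)" if "zs i A \<noteq> 0" for i A
    using assms that by (auto simp: graded_eval_ok_def grass_odd_def)
  show ?case unfolding append_Nil word_eval_Cons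
    by (rule grass_mult_left_commute) (auto split: sum.splits dest!: y z)
next
  case (Cons l us)
  show ?case unfolding append_Cons word_eval_Cons[of _ _ l] Cons.IH grass_mult_scale_right ..
qed

lemma list_sign_odd_indices_swap:
  assumes "distinct (us @ a # b # vs)"
  shows "list_sign (odd_indices (us @ a # b # vs))
     = (if isl a \<or> isl b then 1 else - 1) * list_sign (odd_indices (us @ b # a # vs))"
proof (cases a; cases b)
  fix i j assume [simp]: "a = Inr i" "b = Inr j"
  have "distinct (odd_indices us @ i # j # odd_indices vs)"
    using distinct_odd_indices[OF assms] by simp
  from list_sign_swap[OF this] show ?thesis by simp
qed auto

text \<open>Exchanging two neighbours multiplies the value and the sign of the odd arrangement by
  the same factor, -1 exactly when both letters are odd. Their product is therefore unchanged under
  any rearrangement.\<close>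

lemma word_eval_mset_eq:
  fixes ys zs :: "nat \<Rightarrow> 'a::field grass"
  assumes "graded_eval_ok ys zs" "distinct w" "mset w' = mset w"
  shows "of_int (list_sign (odd_indices w')) * word_eval ys zs w' C
       = of_int (list_sign (odd_indices w)) * word_eval ys zs w C"
proof (rule adjacent_swap_invariant[where \<Phi> = "\<lambda>w. of_int (list_sign (odd_indices w)) * word_eval ys zs w C"])
  fix us a b vs assume "mset (us @ a # b # vs) = mset w"
  hence "distinct (us @ a # b # vs)" using assms(2) mset_eq_imp_distinct_iff by blast
  from list_sign_odd_indices_swap[OF this]
  show "of_int (list_sign (odd_indices (us @ a # b # vs))) * word_eval ys zs (us @ a # b # vs) C
      = of_int (list_sign (odd_indices (us @ b # a # vs))) * word_eval ys zs (us @ b # a # vs) C"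
    using fun_cong[OF word_eval_swap[OF assms(1), of us a b vs], of C] by simp
qed (rule assms(3))

lemma word_eval_parity:
  fixes ys zs :: "nat \<Rightarrow> 'a::field grass"
  assumes "graded_eval_ok ys zs"
  shows "word_eval ys zs w \<in> grass_carrier \<and>
    (\<forall>C. word_eval ys zs w C \<noteq> 0 \<longrightarrow> even (card C) = even (length (odd_indices w)))"
proof (induction w)
  case Nil
  show ?case by (simp add: grass_one_eq_basis grass_basis_carrier)
next
  case (Cons l w)
  let ?u = "case l of Inl i \<Rightarrow> ys i | Inr i \<Rightarrow> zs i"
  have u: "?u \<in> grass_carrier" "\<And>A. ?u A \<noteq> 0 \<Longrightarrow> even (card A) = isl l"
    using assms by (cases l; force simp: graded_eval_ok_def grass_even_def grass_odd_def)+
  have "even (card C) = even (length (odd_indices (l # w)))"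
    if C: "grass_mult ?u (word_eval ys zs w) C \<noteq> 0" for C
  proof -
    obtain A where A: "finite C" "A \<subseteq> C" "?u A \<noteq> 0" "word_eval ys zs w (C - A) \<noteq> 0"
      using C by (rule grass_mult_nonzeroE)
    have "card C = card A + card (C - A)"
      using A by (metis card_Diff_subset card_mono finite_subset le_add_diff_inverse)
    moreover have "even (card (C - A)) = even (length (odd_indices w))" using Cons.IH A(4) by blast
    ultimately show ?thesis using u(2)[OF A(3)] by (cases l) auto
  qed
  thus ?case using u(1) Cons.IH by (simp add: grass_mult_carrier)
qed

section \<open>Traces on quotients\<close>

text \<open>The functionals \<open>\<phi> t\<close> induce the basis of \<open>(V/U)\<^sup>*\<close> dual to the classes of the \<open>d t\<close>.\<close>

locale dual_system = vector_space scale
  for scale :: "'a::field \<Rightarrow> 'b::ab_group_add \<Rightarrow> 'b" +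
  fixes V :: "'b set" and D :: "'t set" and d :: "'t \<Rightarrow> 'b" and \<phi> :: "'t \<Rightarrow> 'b \<Rightarrow> 'a"
  assumes subspace_V: "subspace V"
    and finite_D: "finite D"
    and d_in: "t \<in> D \<Longrightarrow> d t \<in> V"
    and phi_add: "t \<in> D \<Longrightarrow> \<phi> t (x + y) = \<phi> t x + \<phi> t y"
    and phi_scale: "t \<in> D \<Longrightarrow> \<phi> t (scale c x) = c * \<phi> t x"
    and dual: "t \<in> D \<Longrightarrow> t' \<in> D \<Longrightarrow> \<phi> t (d t') = (if t = t' then 1 else 0)"
begin

definition U :: "'b set" where "U = {v \<in> V. \<forall>t\<in>D. \<phi> t v = 0}"

lemma phi_0: "t \<in> D \<Longrightarrow> \<phi> t 0 = 0"
  using phi_scale[of t 0 0] by simp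

lemma phi_minus: "t \<in> D \<Longrightarrow> \<phi> t (- x) = - \<phi> t x"
  using phi_scale[of t "-1" x] by simp

lemma phi_diff: "t \<in> D \<Longrightarrow> \<phi> t (x - y) = \<phi> t x - \<phi> t y"
  using phi_add[of t x "- y"] phi_minus[of t y] by simp

lemma phi_sum: "t \<in> D \<Longrightarrow> \<phi> t (sum f S) = (\<Sum>i\<in>S. \<phi> t (f i))"
  by (induction S rule: infinite_finite_induct) (auto simp: phi_add phi_0)

lemma subspace_U: "subspace U"
  using subspace_V by (auto simp: subspace_def U_def phi_add phi_scale phi_0)

lemma diff_projection_in_U:
  assumes "v \<in> V"
  shows "v - (\<Sum>t\<in>D. scale (\<phi> t v) (d t)) \<in> U"
proof -
  have "v - (\<Sum>t\<in>D. scale (\<phi> t v) (d t)) \<in> V"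
    by (intro subspace_diff[OF subspace_V assms] subspace_sum[OF subspace_V]
        subspace_scale[OF subspace_V] d_in)
  moreover have "\<phi> t (v - (\<Sum>t\<in>D. scale (\<phi> t v) (d t))) = 0" if t: "t \<in> D" for t
  proof -
    have "\<phi> t (\<Sum>t\<in>D. scale (\<phi> t v) (d t)) = (\<Sum>t'\<in>D. if t = t' then \<phi> t' v else 0)"
      unfolding phi_sum[OF t] by (intro sum.cong) (auto simp: phi_scale[OF t] dual t)
    thus ?thesis using t finite_D by (simp add: phi_diff)
  qed
  ultimately show ?thesis by (simp add: U_def)
qed

text \<open>The functional \<phi> t vanishes on \<open>U\<close> and on every other
  \<open>d t'\<close>, but is 1 on \<open>d t\<close>, so \<open>d t\<close> is outside the span of
  what precedes it.\<close>

lemma independent_extend: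
  assumes "independent BU" "span BU = U" "D' \<subseteq> D" and fin: "finite BU"
  shows "independent (BU \<union> d ` D') \<and> card (BU \<union> d ` D') = card BU + card D'"
proof -
  have "finite D'" using assms(3) finite_D finite_subset by auto
  from this assms(3) show ?thesis
  proof (induction D')
    case (insert t D')
    have t: "t \<in> D" using insert by auto
    have ns: "d t \<notin> span (BU \<union> d ` D')"
    proof
      assume "d t \<in> span (BU \<union> d ` D')"
      hence "\<phi> t (d t) = 0"
      proof (induction rule: span_induct_alt)
        case (step c x y)
        have "x \<in> U \<or> x \<in> d ` D'" using step(1) assms(2) span_superset by blast
        hence "\<phi> t x = 0" using t insert by (auto simp: U_def dual)
        thus ?case using step t by (simp add: phi_add phi_scale)
      qed (use t phi_0 in auto)
      thus False using dual[OF t t] by simp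
    qed
    have nb: "d t \<notin> BU \<union> d ` D'"
      by (rule notI, rule notE[OF ns], rule span_base)
    have IH: "independent (BU \<union> d ` D')" "card (BU \<union> d ` D') = card BU + card D'"
      using insert by simp_all
    have eq: "BU \<union> d ` insert t D' = insert (d t) (BU \<union> d ` D')" by simp
    have "independent (insert (d t) (BU \<union> d ` D'))"
      by (rule independent_insertI[OF ns IH(1)])
    moreover have "card (insert (d t) (BU \<union> d ` D')) = Suc (card BU + card D')"
      using nb IH(2) fin insert.hyps(1) by (subst card_insert_disjoint) auto
    ultimately show ?case unfolding eq using insert.hyps by simp
  qed (use assms in auto)
qed

lemma span_extend:
  assumes "span BU = U"
  shows "span (BU \<union> d ` D) = V"
proof
  have "BU \<subseteq> V" using assms span_superset[of BU] by (auto simp: U_def)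
  thus "span (BU \<union> d ` D) \<subseteq> V" using d_in by (intro span_minimal[OF _ subspace_V]) auto
  show "V \<subseteq> span (BU \<union> d ` D)"
  proof
    fix v assume "v \<in> V"
    hence "v - (\<Sum>t\<in>D. scale (\<phi> t v) (d t)) \<in> span BU"
      using diff_projection_in_U assms by simp
    hence "v - (\<Sum>t\<in>D. scale (\<phi> t v) (d t)) \<in> span (BU \<union> d ` D)"
      using span_mono[of BU "BU \<union> d ` D"] by auto
    moreover have "(\<Sum>t\<in>D. scale (\<phi> t v) (d t)) \<in> span (BU \<union> d ` D)"
      by (intro span_sum span_scale span_base) auto
    ultimately show "v \<in> span (BU \<union> d ` D)"
      using span_add by fastforce
  qed
qed

text \<open>The finite spanning set makes a basis of \<open>U\<close> finite, and adding the
  \<open>d t\<close> gives a basis of \<open>V\<close>. Thus an adapted pair of the kind chosen in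
  \<open>quot_trace\<close> exists.\<close>

lemma basis_extend_exists:
  assumes "finite S" "V \<subseteq> span S"
  obtains BU B where "BU \<subseteq> B" "finite B" "independent B" "span B = V" "span BU = U"
    "dim V = dim U + card D"
proof -
  obtain BU where BU: "BU \<subseteq> U" "independent BU" "U \<subseteq> span BU" "card BU = dim U"
    using basis_exists[of U] by blast
  have sp: "span BU = U" using BU span_minimal[OF BU(1) subspace_U] by auto
  have fin: "finite BU"
    using independent_span_bound[OF assms(1) BU(2)] BU(1) assms(2) by (auto simp: U_def)
  let ?B = "BU \<union> d ` D"
  have ind: "independent ?B" "card ?B = card BU + card D"
    using independent_extend[OF BU(2) sp subset_refl fin] by auto
  have spB: "span ?B = V" by (rule span_extend[OF sp])
  have "dim V = card ?B" using dim_span_eq_card_independent[OF ind(1)] spB by simp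
  with ind BU fin finite_D sp spB show ?thesis by (intro that[of BU ?B]) auto
qed

text \<open>The pair \<open>BU\<close>, \<open>B\<close> is arbitrary here, which is the
  independence of the choice. Modulo \<open>U\<close> there are two bases of the quotient, the
  classes of \<open>B - BU\<close> and those of the \<open>d t\<close>; exchanging the two
  summations is the usual argument that a trace is basis independent.\<close>

lemma quotient_trace_eq:
  assumes "BU \<subseteq> B" "finite B" "independent B" "span B = V" "span BU = U"
    and g_add: "\<And>x y. g (x + y) = g x + g y"
    and g_scale: "\<And>c x. g (scale c x) = scale c (g x)"
    and gV: "\<And>x. x \<in> V \<Longrightarrow> g x \<in> V" and gU: "\<And>x. x \<in> U \<Longrightarrow> g x \<in> U"
  shows "(\<Sum>b\<in>B - BU. representation B (g b) b) = (\<Sum>t\<in>D. \<phi> t (g (d t)))"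
proof -
  let ?r = "representation B"
  have g0: "g 0 = 0" using g_scale[of 0 0] by simp
  have g_sum: "g (sum f S) = (\<Sum>i\<in>S. g (f i))" for f and S :: "'b set"
    by (induction S rule: infinite_finite_induct) (auto simp: g_add g0)
  have rU: "?r u b = 0" if "u \<in> U" "b \<in> B - BU" for u b
  proof -
    have "?r u = representation BU u"
      using that assms by (intro representation_extend) auto
    thus ?thesis using representation_ne_zero[of BU u b] that by auto
  qed
  \<comment> \<open>Replacing \<open>v\<close> by its projection onto the \<open>d t\<close> changes
    it by an element of \<open>U\<close>, which has no coordinates off \<open>BU\<close>.\<close>
  have r_eq: "?r v b = (\<Sum>t\<in>D. \<phi> t v * ?r (d t) b)" if v: "v \<in> V" and b: "b \<in> B - BU" for v b
  proof -
    let ?p = "\<Sum>t\<in>D. scale (\<phi> t v) (d t)"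
    have pV: "?p \<in> span B" unfolding assms(4)
      by (intro subspace_sum[OF subspace_V] subspace_scale[OF subspace_V] d_in)
    have "?r v b - ?r ?p b = ?r (v - ?p) b"
      using representation_diff[OF assms(3), of ?p v] v pV assms(4) by simp
    also have "\<dots> = 0" by (rule rU[OF diff_projection_in_U[OF v] b])
    also have "?r ?p b = (\<Sum>t\<in>D. ?r (scale (\<phi> t v) (d t)) b)"
      using representation_sum[OF assms(3), of D "\<lambda>t. scale (\<phi> t v) (d t)"] assms(4)
        subspace_scale[OF subspace_V] d_in by auto
    also have "\<dots> = (\<Sum>t\<in>D. \<phi> t v * ?r (d t) b)"
      by (intro sum.cong refl) (use representation_scale[OF assms(3)] assms(4) d_in in auto)
    finally show ?thesis by simp
  qed
  have BV: "b \<in> V" if "b \<in> B" for b using span_base[OF that] assms(4) by simp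
  have "(\<Sum>b\<in>B - BU. ?r (g b) b) = (\<Sum>b\<in>B - BU. \<Sum>t\<in>D. \<phi> t (g b) * ?r (d t) b)"
    by (intro sum.cong refl r_eq gV BV) auto
  also have "\<dots> = (\<Sum>t\<in>D. \<Sum>b\<in>B - BU. \<phi> t (g b) * ?r (d t) b)"
    by (rule sum.swap)
  also have "\<dots> = (\<Sum>t\<in>D. \<phi> t (g (d t)))"
  proof (rule sum.cong[OF refl])
    fix t assume t: "t \<in> D"
    have "d t = (\<Sum>b\<in>B. scale (?r (d t) b) b)"
      using sum_representation_eq[OF assms(3) _ assms(2), of "d t"] d_in[OF t] assms(4) by simp
    also have "\<dots> = (\<Sum>b\<in>B - BU. scale (?r (d t) b) b) + (\<Sum>b\<in>BU. scale (?r (d t) b) b)"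
      by (rule sum.subset_diff[OF assms(1,2)])
    finally have dt: "d t = \<dots>" .
    \<comment> \<open>The \<open>BU\<close> part of \<open>d t\<close> stays in \<open>U\<close>
      under \<open>g\<close>, where \<phi> t vanishes; only the sum over \<open>B - BU\<close>
      survives.\<close>
    have "(\<Sum>b\<in>BU. scale (?r (d t) b) b) \<in> U"
      unfolding assms(5)[symmetric] by (intro span_sum span_scale span_base)
    hence "\<phi> t (g (\<Sum>b\<in>BU. scale (?r (d t) b) b)) = 0" using gU t by (auto simp: U_def)
    hence "\<phi> t (g (d t)) = \<phi> t (g (\<Sum>b\<in>B - BU. scale (?r (d t) b) b))"
      by (subst dt) (simp add: g_add phi_add[OF t])
    also have "\<dots> = (\<Sum>b\<in>B - BU. \<phi> t (g b) * ?r (d t) b)"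
      by (simp add: g_sum phi_sum[OF t] g_scale phi_scale[OF t] mult.commute)
    finally show "(\<Sum>b\<in>B - BU. \<phi> t (g b) * ?r (d t) b) = \<phi> t (g (d t))" ..
  qed
  finally show ?thesis .
qed

end

section \<open>Multilinear identities and central polynomials\<close>

definition multilin_words :: "nat \<Rightarrow> (nat + nat) list set" where
  "multilin_words n = {w. multilin_word n w}"

lemma multilin_word_distinct: "multilin_word n w \<Longrightarrow> distinct w"
  by (auto simp: multilin_word_def distinct_map)

lemma finite_multilin_words: "finite (multilin_words n)"
proof (rule finite_subset)
  show "multilin_words n \<subseteq> {w. set w \<subseteq> Inl ` {1..n} \<union> Inr ` {1..n} \<and> length w = n}"
  proof safe
    fix w assume "w \<in> multilin_words n"
    hence w: "distinct (map letter_index w)" "letter_index ` set w = {1..n}"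
      by (auto simp: multilin_words_def multilin_word_def)
    show "length w = n" using distinct_card[OF w(1)] w(2) by simp
    fix l assume l: "l \<in> set w" "l \<notin> Inr ` {1..n}"
    hence "letter_index l \<in> {1..n}" using w(2) by blast
    thus "l \<in> Inl ` {1..n}" using l(2) by (cases l) (auto simp: letter_index_def)
  qed
  show "finite {w. set w \<subseteq> Inl ` {1..n} \<union> Inr ` {1..n} \<and> length w = n}"
    by (rule finite_lists_length_eq) auto
qed

lemma odd_indices_subset: "multilin_word n w \<Longrightarrow> set (odd_indices w) \<subseteq> {1..n}"
proof
  fix i assume "multilin_word n w" "i \<in> set (odd_indices w)"
  hence "letter_index (Inr i) \<in> {1..n}"
    unfolding multilin_word_def set_odd_indices by (metis imageI mem_Collect_eq set_map)
  thus "i \<in> {1..n}" by (simp add: letter_index_def)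
qed

definition canonical_word :: "nat \<Rightarrow> nat set \<Rightarrow> (nat + nat) list" where
  "canonical_word n T = map (\<lambda>i. if i \<in> T then Inr i else Inl i) [1..<Suc n]"

lemma multilin_canonical_word: "multilin_word n (canonical_word n T)"
proof -
  have "map letter_index (canonical_word n T) = [1..<Suc n]"
    unfolding canonical_word_def map_map by (rule map_idI) (simp add: letter_index_def)
  thus ?thesis unfolding multilin_word_def by (simp only: distinct_upt set_upt) auto
qed

lemma odd_indices_canonical_word:
  assumes "T \<subseteq> {1..n}"
  shows "odd_indices (canonical_word n T) = sorted_list_of_set T"
proof -
  have f: "odd_indices (map (\<lambda>i. if i \<in> T then Inr i else Inl i) l) = filter (\<lambda>i. i \<in> T) l" for l
    by (induction l) auto
  have s: "set (filter (\<lambda>i. i \<in> T) [1..<Suc n]) = T" using assms by (auto simp del: upt_Suc)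
  have "sorted_list_of_set (set (filter (\<lambda>i. i \<in> T) [1..<Suc n])) = filter (\<lambda>i. i \<in> T) [1..<Suc n]"
    by (rule sorted_list_of_set.idem_if_sorted_distinct)
      (auto simp del: upt_Suc intro!: sorted_filter[of "\<lambda>x. x", simplified])
  thus ?thesis unfolding s canonical_word_def f by simp
qed

text \<open>Each index occurs in exactly one letter, so the odd indices determine the set of
  letters; as both words are distinct, equal sets give equal multisets.\<close>

lemma mset_canonical_word:
  assumes w: "multilin_word n w"
  shows "mset w = mset (canonical_word n (set (odd_indices w)))"
proof -
  have inj: "inj_on letter_index (set w)" and im: "letter_index ` set w = {1..n}"
    using w by (auto simp: multilin_word_def distinct_map)
  have "l \<in> set w \<longleftrightarrow> l \<in> set (canonical_word n (set (odd_indices w)))" for l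
  proof (cases l)
    case (Inr i)
    thus ?thesis using odd_indices_subset[OF w]
      by (force simp: canonical_word_def set_odd_indices simp del: upt_Suc)
  next
    case (Inl i)
    have "Inl i \<in> set w \<longleftrightarrow> i \<in> {1..n} \<and> Inr i \<notin> set w"
    proof
      assume l: "Inl i \<in> set w"
      hence "letter_index (Inl i) \<in> {1..n}" using im by blast
      moreover have "Inr i \<notin> set w"
        using inj_onD[OF inj, of "Inl i" "Inr i"] l by (auto simp: letter_index_def)
      ultimately show "i \<in> {1..n} \<and> Inr i \<notin> set w" by (simp add: letter_index_def)
    next
      assume i: "i \<in> {1..n} \<and> Inr i \<notin> set w"
      then obtain l where l: "l \<in> set w" "letter_index l = i" using im by (metis imageE)
      show "Inl i \<in> set w"
      proof (cases l)
        case (Inl j)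
        hence "j = i" using l(2) by (simp add: letter_index_def)
        thus ?thesis using l(1) Inl by simp
      next
        case (Inr j)
        hence "j = i" using l(2) by (simp add: letter_index_def)
        thus ?thesis using l(1) Inr i by simp
      qed
    qed
    thus ?thesis using Inl by (auto simp: canonical_word_def set_odd_indices simp del: upt_Suc)
  qed
  thus ?thesis
    using multilin_word_distinct[OF w] multilin_word_distinct[OF multilin_canonical_word]
    by (subst set_eq_iff_mset_eq_distinct[symmetric]) auto
qed

definition words_of_type :: "nat \<Rightarrow> nat set \<Rightarrow> (nat + nat) list set" where
  "words_of_type n T = {w \<in> multilin_words n. set (odd_indices w) = T}"

lemma finite_words_of_type: "finite (words_of_type n T)"
  using finite_multilin_words by (simp add: words_of_type_def)

text \<open>Modulo the graded identities, the component of \<open>f\<close> with odd variables \<open>T\<close> is \<open>signed_sum n T f\<close>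
  times the canonical monomial.\<close>

definition signed_sum :: "nat \<Rightarrow> nat set \<Rightarrow> 'a::field fpoly \<Rightarrow> 'a" where
  "signed_sum n T f = (\<Sum>w\<in>words_of_type n T. of_int (list_sign (odd_indices w)) * f w)"

lemma word_eval_words_of_type:
  fixes ys zs :: "nat \<Rightarrow> 'a::field grass"
  assumes "graded_eval_ok ys zs" "w \<in> words_of_type n T"
  shows "word_eval ys zs w C
     = of_int (list_sign (odd_indices w)) * word_eval ys zs (canonical_word n T) C"
proof -
  have w: "multilin_word n w" "set (odd_indices w) = T"
    using assms(2) by (auto simp: words_of_type_def multilin_words_def)
  hence T: "T \<subseteq> {1..n}" using odd_indices_subset by blast
  have "of_int (list_sign (odd_indices w)) * word_eval ys zs w C
      = of_int (list_sign (odd_indices (canonical_word n T))) * word_eval ys zs (canonical_word n T) C"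
    using mset_canonical_word[OF w(1)] multilin_word_distinct[OF multilin_canonical_word] w(2)
    by (intro word_eval_mset_eq[OF assms(1)]) auto
  also have "list_sign (odd_indices (canonical_word n T)) = 1"
    using T odd_indices_canonical_word[OF T] finite_subset[OF T]
    by (simp add: list_sign_sorted_list_of_set)
  finally have "word_eval ys zs (canonical_word n T) C
      = of_int (list_sign (odd_indices w)) * word_eval ys zs w C" by simp
  moreover have "(of_int (list_sign (odd_indices w)) :: 'a) * of_int (list_sign (odd_indices w)) = 1"
    using list_sign_square[OF distinct_odd_indices[OF multilin_word_distinct[OF w(1)]]]
    by (simp flip: of_int_mult)
  ultimately show ?thesis by (simp flip: mult.assoc)
qed

lemma fpoly_eval_P_gr:
  fixes ys zs :: "nat \<Rightarrow> 'a::field grass"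
  assumes "graded_eval_ok ys zs" "f \<in> P_gr n"
  shows "fpoly_eval f ys zs
     = (\<lambda>C. \<Sum>T\<in>Pow {1..n}. signed_sum n T f * word_eval ys zs (canonical_word n T) C)"
proof
  fix C
  have "fpoly_eval f ys zs C = (\<Sum>w\<in>{w. f w \<noteq> 0}. f w * word_eval ys zs w C)"
    by (simp add: fpoly_eval_def word_eval_def)
  also have "\<dots> = (\<Sum>w\<in>multilin_words n. f w * word_eval ys zs w C)"
    using assms(2) finite_multilin_words
    by (intro sum.mono_neutral_left) (auto simp: P_gr_def multilin_words_def)
  also have "\<dots> = (\<Sum>T\<in>Pow {1..n}. \<Sum>w\<in>words_of_type n T. f w * word_eval ys zs w C)"
    unfolding words_of_type_def using finite_multilin_words odd_indices_subset
    by (intro sum.group[symmetric]) (auto simp: multilin_words_def)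
  also have "\<dots> = (\<Sum>T\<in>Pow {1..n}. signed_sum n T f * word_eval ys zs (canonical_word n T) C)"
    unfolding signed_sum_def sum_distrib_right
    by (intro sum.cong refl) (simp add: word_eval_words_of_type[OF assms(1)])
  finally show "fpoly_eval f ys zs C = \<dots>" .
qed

lemma finite_support_P_gr: "f \<in> P_gr n \<Longrightarrow> finite {w. f w \<noteq> 0}"
  by (rule finite_subset[OF _ finite_multilin_words[of n]]) (auto simp: P_gr_def multilin_words_def)

text \<open>Put z_i = e_i for i in \<open>T\<close> and y_i = 1 for the other i, and send every
  remaining variable to 0. A canonical word of another type contains a letter that becomes 0, while
  the word of type \<open>T\<close> becomes a nonzero multiple of e_T.\<close>

lemma exists_separating_eval:
  assumes "T \<subseteq> {1..n}"
  obtains ys zs :: "nat \<Rightarrow> 'a::field grass" and c where "graded_eval_ok ys zs" "c \<noteq> 0"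
    "\<And>f. f \<in> P_gr n \<Longrightarrow> fpoly_eval f ys zs = (\<lambda>C. signed_sum n T f * c * grass_basis T C)"
proof -
  define ys :: "nat \<Rightarrow> 'a grass" where "ys i = (if i \<in> T then (\<lambda>_. 0) else grass_basis {})" for i
  define zs :: "nat \<Rightarrow> 'a grass" where "zs i = (if i \<in> T then grass_basis {i} else (\<lambda>_. 0))" for i
  have "(\<lambda>_. 0) \<in> (grass_even :: 'a grass set)" "(\<lambda>_. 0) \<in> (grass_odd :: 'a grass set)"
    by (auto simp: grass_even_def grass_odd_def grass_carrier_def)
  hence ok: "graded_eval_ok ys zs"
    by (auto simp: graded_eval_ok_def ys_def zs_def intro!: grass_basis_even grass_basis_odd)
  let ?v = "\<lambda>l. case l of Inl i \<Rightarrow> ys i | Inr i \<Rightarrow> zs i"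
  have zero: "word_eval ys zs (canonical_word n T') = (\<lambda>_. 0)" if T': "T' \<subseteq> {1..n}" "T' \<noteq> T" for T'
  proof -
    obtain i where i: "i \<in> {1..n}" "i \<in> T' \<longleftrightarrow> i \<notin> T" using T' assms by blast
    have v0: "?v (if i \<in> T' then Inr i else Inl i) = (\<lambda>_. 0)" using i by (auto simp: ys_def zs_def)
    have v1: "(if i \<in> T' then Inr i else Inl i) \<in> set (canonical_word n T')"
      using i(1) by (auto simp: canonical_word_def simp del: upt_Suc)
    have "(\<lambda>_. 0) \<in> set (map ?v (canonical_word n T'))"
      using imageI[OF v1, of ?v] unfolding v0 set_map .
    thus ?thesis unfolding word_eval_def by (rule grass_prod_eq_zero)
  qed
  have "map ?v (canonical_word n T) = map (\<lambda>i. grass_basis (if i \<in> T then {i} else {})) [1..<Suc n]"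
    unfolding canonical_word_def map_map by (rule map_cong[OF refl]) (simp add: ys_def zs_def)
  moreover obtain c :: 'a where c: "c \<noteq> 0"
    "grass_prod (map (\<lambda>i. grass_basis (if i \<in> T then {i} else {})) [1..<Suc n])
       = (\<lambda>C. c * grass_basis (set [1..<Suc n] \<inter> T) C)"
    using grass_prod_basis[of "[1..<Suc n]" T] by (metis distinct_upt)
  moreover have "set [1..<Suc n] \<inter> T = T" using assms by (auto simp del: upt_Suc)
  ultimately have one: "word_eval ys zs (canonical_word n T) = (\<lambda>C. c * grass_basis T C)"
    by (simp only: word_eval_def)
  show ?thesis
  proof (rule that[OF ok c(1)])
    fix f :: "'a fpoly" assume f: "f \<in> P_gr n"
    show "fpoly_eval f ys zs = (\<lambda>C. signed_sum n T f * c * grass_basis T C)"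
    proof
      fix C
      have "fpoly_eval f ys zs C
         = (\<Sum>T'\<in>Pow {1..n}. if T' = T then signed_sum n T f * c * grass_basis T C else 0)"
        unfolding fpoly_eval_P_gr[OF ok f] by (intro sum.cong) (auto simp: zero one)
      thus "fpoly_eval f ys zs C = signed_sum n T f * c * grass_basis T C" using assms by simp
    qed
  qed
qed

lemma P_gr_Int_Id_gr:
  "P_gr n \<inter> Id_gr = {f \<in> P_gr n. \<forall>T\<in>Pow {1..n}. signed_sum n T f = (0 :: 'a::field)}"
proof (intro equalityI subsetI, goal_cases)
  case (1 f)
  hence f: "f \<in> P_gr n" "f \<in> Id_gr" by auto
  have "signed_sum n T f = 0" if T: "T \<subseteq> {1..n}" for T
  proof -
    obtain ys zs :: "nat \<Rightarrow> 'a grass" and c where e: "graded_eval_ok ys zs" "c \<noteq> 0"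
      "\<And>f. f \<in> P_gr n \<Longrightarrow> fpoly_eval f ys zs = (\<lambda>C. signed_sum n T f * c * grass_basis T C)"
      using exists_separating_eval[OF T, where ?'a = 'a] by metis
    have "fpoly_eval f ys zs = (\<lambda>_. 0)" using f(2) e(1) unfolding Id_gr_def by blast
    hence "signed_sum n T f * c * grass_basis T T = 0" using e(3)[OF f(1)] by metis
    thus ?thesis using e(2) by simp
  qed
  thus ?case using f by auto
next
  case (2 f)
  hence f: "f \<in> P_gr n" "\<And>T. T \<in> Pow {1..n} \<Longrightarrow> signed_sum n T f = 0" by auto
  have "fpoly_eval f ys zs = (\<lambda>_. 0)" if "graded_eval_ok ys zs" for ys zs
    unfolding fpoly_eval_P_gr[OF that f(1)] using f(2) by simp
  thus ?case using f(1) finite_support_P_gr[OF f(1)] unfolding Id_gr_def by blast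
qed

lemma P_gr_Int_C_gr:
  assumes "n \<ge> 1"
  shows "P_gr n \<inter> C_gr
    = {f \<in> P_gr n. \<forall>T\<in>{T. T \<subseteq> {1..n} \<and> odd (card T)}. signed_sum n T f = (0 :: 'a::field_char_0)}"
proof (intro equalityI subsetI, goal_cases)
  case (1 f)
  hence f: "f \<in> P_gr n" "f \<in> C_gr" by auto
  have "signed_sum n T f = 0" if T: "T \<subseteq> {1..n}" "odd (card T)" for T
  proof -
    obtain ys zs :: "nat \<Rightarrow> 'a grass" and c where e: "graded_eval_ok ys zs" "c \<noteq> 0"
      "\<And>f. f \<in> P_gr n \<Longrightarrow> fpoly_eval f ys zs = (\<lambda>C. signed_sum n T f * c * grass_basis T C)"
      using exists_separating_eval[OF T(1), where ?'a = 'a] by metis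
    have "fpoly_eval f ys zs \<in> grass_center" using f(2) e(1) unfolding C_gr_def by blast
    hence "(\<lambda>C. signed_sum n T f * c * grass_basis T C) \<in> grass_center" using e(3)[OF f(1)] by metis
    \<comment> \<open>Variables are numbered from 1 but generators from 0, so the generator with
      index 0 does not occur in \<open>T\<close>.\<close>
    hence "signed_sum n T f * c = 0"
      by (rule odd_basis_not_central) (use T finite_subset[OF T(1)] in auto)
    thus ?thesis using e(2) by simp
  qed
  thus ?case using f by auto
next
  case (2 f)
  hence f: "f \<in> P_gr n" "\<And>T. T \<subseteq> {1..n} \<Longrightarrow> odd (card T) \<Longrightarrow> signed_sum n T f = 0" by auto
  \<comment> \<open>Here n \<ge> 1 enters: the empty word is multilinear only for n = 0, so the
    condition on the constant term holds automatically.\<close>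
  have "\<not> multilin_word n []" using assms by (auto simp: multilin_word_def)
  hence "f [] = 0" using f(1) by (auto simp: P_gr_def)
  moreover have "fpoly_eval f ys zs \<in> grass_center" if ok: "graded_eval_ok ys zs" for ys zs
  proof -
    let ?E = "{T. T \<subseteq> {1..n} \<and> even (card T)}"
    have fin: "finite ?E" by (rule finite_subset[of _ "Pow {1..n}"]) auto
    have "word_eval ys zs (canonical_word n T) \<in> grass_even" if T: "T \<in> ?E" for T
    proof -
      have "length (odd_indices (canonical_word n T)) = card T"
        using T odd_indices_canonical_word[of T n] by simp
      thus ?thesis using word_eval_parity[OF ok, of "canonical_word n T"] T
        unfolding grass_even_def by auto
    qed
    hence "(\<lambda>C. \<Sum>T\<in>?E. signed_sum n T f * word_eval ys zs (canonical_word n T) C) \<in> grass_even"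
      by (rule grass_even_sum[OF fin])
    moreover have "(\<Sum>T\<in>Pow {1..n}. signed_sum n T f * word_eval ys zs (canonical_word n T) C)
       = (\<Sum>T\<in>?E. signed_sum n T f * word_eval ys zs (canonical_word n T) C)" for C
      by (rule sum.mono_neutral_right) (use f(2) in auto)
    ultimately show ?thesis unfolding fpoly_eval_P_gr[OF ok f(1)] by (intro grass_even_center) simp
  qed
  ultimately show ?case using f(1) finite_support_P_gr[OF f(1)] unfolding C_gr_def by blast
qed

section \<open>Dimensions and traces from the signed sums\<close>

lemma vector_space_fscale: "vector_space (fscale :: 'a::field \<Rightarrow> 'a fpoly \<Rightarrow> 'a fpoly)"
  by unfold_locales (auto simp: fun_eq_iff algebra_simps)

definition word_monomial :: "(nat + nat) list \<Rightarrow> 'a::field fpoly" where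
  "word_monomial v = (\<lambda>w. if w = v then 1 else 0)"

lemma signed_sum_add: "signed_sum n T (f + g) = signed_sum n T f + signed_sum n T g"
  by (simp add: signed_sum_def algebra_simps sum.distrib)

lemma signed_sum_scale: "signed_sum n T (fscale c f) = c * signed_sum n T f"
  by (simp add: signed_sum_def sum_distrib_left algebra_simps)

lemma signed_sum_canonical:
  assumes "T \<subseteq> {1..n}" "T' \<subseteq> {1..n}"
  shows "signed_sum n T (word_monomial (canonical_word n T') :: 'a::field fpoly) = (if T = T' then 1 else 0)"
proof -
  let ?v = "canonical_word n T'"
  have o: "odd_indices ?v = sorted_list_of_set T'" by (rule odd_indices_canonical_word[OF assms(2)])
  have fin: "finite T'" using assms(2) finite_subset by blast
  have "?v \<in> words_of_type n T \<longleftrightarrow> T = T'"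
    using multilin_canonical_word o fin by (auto simp: words_of_type_def multilin_words_def)
  moreover have "signed_sum n T (word_monomial ?v :: 'a fpoly)
      = (\<Sum>w\<in>words_of_type n T. if w = ?v then of_int (list_sign (odd_indices ?v)) else 0)"
    unfolding signed_sum_def by (intro sum.cong) (auto simp: word_monomial_def)
  ultimately show ?thesis
    using finite_words_of_type list_sign_sorted_list_of_set[OF fin] by (simp add: o)
qed

lemma canonical_monomial_P_gr: "word_monomial (canonical_word n T) \<in> P_gr n"
  using multilin_canonical_word by (auto simp: P_gr_def word_monomial_def)

lemma sum_fun_apply: "(\<Sum>i\<in>S. F i) x = (\<Sum>i\<in>S. F i x :: 'b::comm_monoid_add)"
  by (induction S rule: infinite_finite_induct) auto

lemma P_gr_finitely_spanned:
  "P_gr n \<subseteq> module.span fscale (word_monomial ` multilin_words n :: 'a::field fpoly set)"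
proof
  interpret vector_space "fscale :: 'a \<Rightarrow> 'a fpoly \<Rightarrow> 'a fpoly" by (rule vector_space_fscale)
  fix f :: "'a fpoly" assume f: "f \<in> P_gr n"
  have "f = (\<Sum>v\<in>multilin_words n. fscale (f v) (word_monomial v))"
  proof
    fix w
    have "(\<Sum>v\<in>multilin_words n. fscale (f v) (word_monomial v)) w
       = (\<Sum>v\<in>multilin_words n. if w = v then f v else 0)"
      unfolding sum_fun_apply by (intro sum.cong) (auto simp: word_monomial_def)
    also have "\<dots> = f w"
      using f finite_multilin_words[of n] by (auto simp: P_gr_def multilin_words_def)
    finally show "f w = (\<Sum>v\<in>multilin_words n. fscale (f v) (word_monomial v)) w" ..
  qed
  also have "\<dots> \<in> span (word_monomial ` multilin_words n)"
    by (intro span_sum span_scale span_base imageI)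
  finally show "f \<in> span (word_monomial ` multilin_words n)" .
qed

text \<open>Disjointness of \<open>S\<close> and \<open>D\<close> puts the canonical monomials of
  types in \<open>D\<close> into the common kernel of the functionals in \<open>S\<close>, and among
  themselves they are dual to the functionals in \<open>D\<close>.\<close>

lemma dual_system_signed_sum:
  assumes "S \<subseteq> Pow {1..n}" "D \<subseteq> Pow {1..n}" "S \<inter> D = {}"
  shows "dual_system fscale {f \<in> P_gr n. \<forall>T\<in>S. signed_sum n T f = (0 :: 'a::field)} D
    (\<lambda>T. word_monomial (canonical_word n T)) (signed_sum n)"
proof -
  interpret vector_space "fscale :: 'a \<Rightarrow> 'a fpoly \<Rightarrow> 'a fpoly" by (rule vector_space_fscale)
  have "signed_sum n T (0 :: 'a fpoly) = 0" for T by (simp add: signed_sum_def)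
  moreover have "(0 :: 'a fpoly) \<in> P_gr n" by (simp add: P_gr_def)
  moreover have "f + g \<in> P_gr n" if "f \<in> P_gr n" "g \<in> P_gr n" for f g :: "'a fpoly"
    using that by (auto simp: P_gr_def) (metis add.right_neutral)
  moreover have "fscale c f \<in> P_gr n" if "f \<in> P_gr n" for c and f :: "'a fpoly"
    using that by (auto simp: P_gr_def)
  ultimately have "subspace {f \<in> P_gr n. \<forall>T\<in>S. signed_sum n T f = (0 :: 'a)}"
    by (auto simp: subspace_def signed_sum_add signed_sum_scale)
  moreover have "finite D" using assms(2) finite_subset by blast
  moreover have "signed_sum n T (word_monomial (canonical_word n T') :: 'a fpoly) = 0"
    if "T \<in> S" "T' \<in> D" for T T'
    using that assms by (subst signed_sum_canonical) auto
  moreover have "signed_sum n T (word_monomial (canonical_word n T') :: 'a fpoly) = (if T = T' then 1 else 0)"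
    if "T \<in> D" "T' \<in> D" for T T'
    using that assms(2) by (intro signed_sum_canonical) auto
  ultimately show ?thesis
    by unfold_locales (simp_all add: signed_sum_add signed_sum_scale canonical_monomial_P_gr)
qed

definition signed_kernel :: "nat \<Rightarrow> nat set set \<Rightarrow> 'a::field fpoly set" where
  "signed_kernel n S = {f \<in> P_gr n. \<forall>T\<in>S. signed_sum n T f = 0}"

lemma signed_kernel_U:
  assumes "S \<subseteq> Pow {1..n}" "D \<subseteq> Pow {1..n}" "S \<inter> D = {}"
  shows "dual_system.U (signed_kernel n S) D (signed_sum n) = (signed_kernel n (S \<union> D) :: 'a::field fpoly set)"
  using dual_system.U_def[OF dual_system_signed_sum[OF assms]]
  by (auto simp: signed_kernel_def)

text \<open>Passing from \<open>S\<close> to \<open>S \<union> D\<close> imposes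
  \<open>card D\<close> independent conditions. For the trace, the choice in
  \<open>quot_trace\<close> is resolved in two halves: some adapted basis exists, and every adapted
  basis yields the stated sum.\<close>

lemma fdim_signed_kernel_and_trace:
  fixes g :: "'a::field fpoly \<Rightarrow> 'a fpoly"
  assumes S: "S \<subseteq> Pow {1..n}" "D \<subseteq> Pow {1..n}" "S \<inter> D = {}"
  shows "fdim (signed_kernel n S :: 'a fpoly set) = fdim (signed_kernel n (S \<union> D) :: 'a fpoly set) + card D"
    and "(\<And>x y. g (x + y) = g x + g y) \<Longrightarrow> (\<And>c x. g (fscale c x) = fscale c (g x)) \<Longrightarrow>
      (\<And>x. x \<in> signed_kernel n S \<Longrightarrow> g x \<in> signed_kernel n S) \<Longrightarrow>
      (\<And>x. x \<in> signed_kernel n (S \<union> D) \<Longrightarrow> g x \<in> signed_kernel n (S \<union> D)) \<Longrightarrow>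
      quot_trace (signed_kernel n S) (signed_kernel n (S \<union> D)) g
        = (\<Sum>T\<in>D. signed_sum n T (g (word_monomial (canonical_word n T))))"
proof -
  interpret dual_system "fscale :: 'a \<Rightarrow> 'a fpoly \<Rightarrow> 'a fpoly" "signed_kernel n S" D
    "\<lambda>T. word_monomial (canonical_word n T)" "signed_sum n"
    unfolding signed_kernel_def by (rule dual_system_signed_sum[OF S])
  have U_eq: "U = signed_kernel n (S \<union> D)" by (rule signed_kernel_U[OF S])
  have sp: "signed_kernel n S \<subseteq> span (word_monomial ` multilin_words n)"
    using P_gr_finitely_spanned[of n] by (auto simp: signed_kernel_def)
  have fin: "finite (word_monomial ` multilin_words n :: 'a fpoly set)"
    using finite_multilin_words by (rule finite_imageI)
  obtain BU B where B: "BU \<subseteq> B" "finite B" "independent B" "span B = signed_kernel n S"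
      "span BU = U" and dim: "dim (signed_kernel n S) = dim U + card D"
    by (rule basis_extend_exists[OF fin sp])
  show "fdim (signed_kernel n S :: 'a fpoly set) = fdim (signed_kernel n (S \<union> D) :: 'a fpoly set) + card D"
    using dim unfolding fdim_def U_eq .
  assume g: "\<And>x y. g (x + y) = g x + g y" "\<And>c x. g (fscale c x) = fscale c (g x)"
    "\<And>x. x \<in> signed_kernel n S \<Longrightarrow> g x \<in> signed_kernel n S"
    "\<And>x. x \<in> signed_kernel n (S \<union> D) \<Longrightarrow> g x \<in> signed_kernel n (S \<union> D)"
  have tr: "(\<Sum>b\<in>B - BU. representation B (g b) b)
      = (\<Sum>T\<in>D. signed_sum n T (g (word_monomial (canonical_word n T))))"
    if b: "BU \<subseteq> B" "finite B" "independent B" "span B = signed_kernel n S"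
        "span BU = signed_kernel n (S \<union> D)" for BU B
  proof (rule quotient_trace_eq[where g = g, OF b(1-4)])
    show "span BU = U" unfolding U_eq by (rule b(5))
  qed (use g U_eq in simp_all)
  show "quot_trace (signed_kernel n S) (signed_kernel n (S \<union> D)) g
        = (\<Sum>T\<in>D. signed_sum n T (g (word_monomial (canonical_word n T))))"
    unfolding quot_trace_def
  proof (rule some_equality)
    show "\<exists>BU B. BU \<subseteq> B \<and> finite B \<and> independent B \<and> span B = signed_kernel n S \<and>
        span BU = signed_kernel n (S \<union> D) \<and>
        (\<Sum>T\<in>D. signed_sum n T (g (word_monomial (canonical_word n T))))
          = (\<Sum>b\<in>B - BU. representation B (g b) b)"
      by (rule exI[of _ BU], rule exI[of _ B],
          intro conjI B(1-4) B(5)[unfolded U_eq] tr[OF B(1-4) B(5)[unfolded U_eq], symmetric])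
  next
    fix t assume "\<exists>BU B. BU \<subseteq> B \<and> finite B \<and> independent B \<and> span B = signed_kernel n S \<and>
        span BU = signed_kernel n (S \<union> D) \<and> t = (\<Sum>b\<in>B - BU. representation B (g b) b)"
    then obtain BU B where b: "BU \<subseteq> B" "finite B" "independent B" "span B = signed_kernel n S"
        "span BU = signed_kernel n (S \<union> D)" and t: "t = (\<Sum>b\<in>B - BU. representation B (g b) b)"
      by blast
    show "t = (\<Sum>T\<in>D. signed_sum n T (g (word_monomial (canonical_word n T))))"
      unfolding t by (rule tr[OF b])
  qed
qed

section \<open>The action of the wreath product\<close>

lemma multilin_word_map_sum:
  assumes "multilin_word n w" "\<sigma> permutes {1..n}"
  shows "multilin_word n (map (map_sum \<sigma> \<sigma>) w)"
proof -
  have eq: "map letter_index (map (map_sum \<sigma> \<sigma>) w) = map \<sigma> (map letter_index w)"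
    by (auto simp: letter_index_def split: sum.splits)
  have "inj_on \<sigma> S" for S using permutes_inj[OF assms(2)] by (rule inj_on_subset) simp
  thus ?thesis using assms(1) permutes_image[OF assms(2)]
    unfolding multilin_word_def eq by (simp add: distinct_map[of \<sigma>] del: map_map)
qed

lemma prod_list_odd_letters:
  "prod_list (map (\<lambda>l. case l of Inl _ \<Rightarrow> 1 | Inr j \<Rightarrow> a j) w) = prod_list (map a (odd_indices w))"
  for a :: "nat \<Rightarrow> 'a::field"
  by (induction w rule: odd_indices.induct) auto

text \<open>Renaming by \<sigma> matches words of type \<open>T'\<close> with words of type
  \<open>T\<close>. The scalars contribute the product over \<open>T\<close>, and the sign change is
  the same for all words of the type, so it can be read off at the increasing list, whose own sign
  is 1.\<close>

lemma signed_sum_wr_act: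
  fixes a :: "nat \<Rightarrow> 'a::field" and f :: "'a fpoly"
  assumes \<sigma>: "\<sigma> permutes {1..n}" and T: "T \<subseteq> {1..n}"
  defines "T' \<equiv> inv_into UNIV \<sigma> ` T"
  shows "signed_sum n T (wr_act a \<sigma> f)
    = (\<Prod>j\<in>T. a j) * of_int (list_sign (map \<sigma> (sorted_list_of_set T'))) * signed_sum n T' f"
proof -
  let ?i = "inv_into UNIV \<sigma>"
  have i_perm: "?i permutes {1..n}" by (rule permutes_inv[OF \<sigma>])
  have i: "?i (\<sigma> x) = x" "\<sigma> (?i x) = x" for x using permutes_inverses[OF \<sigma>] by auto
  have im: "\<sigma> ` T' = T" by (simp add: T'_def image_image i)
  have finT': "finite T'" using T finite_subset unfolding T'_def by blast
  have m: "map_sum ?i ?i (map_sum \<sigma> \<sigma> l) = l" "map_sum \<sigma> \<sigma> (map_sum ?i ?i l) = l" for l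
    by (cases l; simp add: i)+
  let ?\<kappa> = "(\<Prod>j\<in>T. a j) * of_int (list_sign (map \<sigma> (sorted_list_of_set T')))"
  have "signed_sum n T (wr_act a \<sigma> f)
    = (\<Sum>w\<in>words_of_type n T'. ?\<kappa> * (of_int (list_sign (odd_indices w)) * f w))"
    unfolding signed_sum_def
  proof (rule sum.reindex_bij_witness[of _ "map (map_sum \<sigma> \<sigma>)" "map (map_sum ?i ?i)"])
    fix w assume w: "w \<in> words_of_type n T"
    show "map (map_sum \<sigma> \<sigma>) (map (map_sum ?i ?i) w) = w"
      unfolding map_map by (rule map_idI) (simp only: comp_apply m)
    show "map (map_sum ?i ?i) w \<in> words_of_type n T'"
      using w multilin_word_map_sum[OF _ i_perm]
      by (auto simp: words_of_type_def multilin_words_def T'_def)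
    let ?v = "map (map_sum ?i ?i) w"
    have mw: "multilin_word n w" "set (odd_indices w) = T"
      using w by (auto simp: words_of_type_def multilin_words_def)
    have dw: "distinct (odd_indices w)" by (rule distinct_odd_indices[OF multilin_word_distinct[OF mw(1)]])
    have dv: "distinct (odd_indices ?v)"
      by (rule distinct_odd_indices[OF multilin_word_distinct[OF multilin_word_map_sum[OF mw(1) i_perm]]])
    have ov: "map \<sigma> (odd_indices ?v) = odd_indices w" "set (odd_indices ?v) = T'"
      by (simp_all add: T'_def mw(2) comp_def i)
    have "list_sign (odd_indices w)
       = list_sign (map \<sigma> (sorted_list_of_set T')) * list_sign (sorted_list_of_set T') * list_sign (odd_indices ?v)"
      unfolding ov(1)[symmetric]
      by (rule list_sign_map_ratio[OF _ dv _ \<sigma>]) (use ov(2) finT' in auto)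
    hence s: "list_sign (odd_indices w)
       = list_sign (map \<sigma> (sorted_list_of_set T')) * list_sign (odd_indices ?v)"
      by (simp only: list_sign_sorted_list_of_set[OF finT'] mult_1_right)
    have "prod_list (map a (odd_indices w)) = (\<Prod>j\<in>T. a j)"
      using prod.distinct_set_conv_list[OF dw, of a] mw(2) by simp
    thus "?\<kappa> * (of_int (list_sign (odd_indices ?v)) * f ?v)
       = of_int (list_sign (odd_indices w)) * wr_act a \<sigma> f w"
      unfolding s wr_act_def prod_list_odd_letters by (simp add: ac_simps)
  next
    fix w assume w: "w \<in> words_of_type n T'"
    show "map (map_sum ?i ?i) (map (map_sum \<sigma> \<sigma>) w) = w"
      unfolding map_map by (rule map_idI) (simp only: comp_apply m)
    show "map (map_sum \<sigma> \<sigma>) w \<in> words_of_type n T"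
      using w multilin_word_map_sum[OF _ \<sigma>] im
      by (auto simp: words_of_type_def multilin_words_def)
  qed
  thus ?thesis by (simp add: signed_sum_def sum_distrib_left)
qed

lemma wr_act_P_gr:
  assumes "\<sigma> permutes {1..n}" "f \<in> P_gr n"
  shows "wr_act a \<sigma> f \<in> P_gr n"
proof -
  let ?i = "inv_into UNIV \<sigma>"
  have "multilin_word n w" if "wr_act a \<sigma> f w \<noteq> 0" for w
  proof -
    have "multilin_word n (map (map_sum ?i ?i) w)"
      using that assms(2) by (auto simp: wr_act_def P_gr_def)
    from multilin_word_map_sum[OF this assms(1)]
    have "multilin_word n (map (map_sum \<sigma> \<sigma>) (map (map_sum ?i ?i) w))" .
    moreover have "map_sum \<sigma> \<sigma> (map_sum ?i ?i l) = l" for l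
      using permutes_inverses[OF assms(1)] by (cases l) auto
    hence "map (map_sum \<sigma> \<sigma>) (map (map_sum ?i ?i) w) = w"
      unfolding map_map by (intro map_idI) (simp only: comp_apply)
    ultimately show ?thesis by simp
  qed
  thus ?thesis by (simp add: P_gr_def)
qed

lemma wr_act_signed_kernel:
  assumes \<sigma>: "\<sigma> permutes {1..n}" and S: "S \<subseteq> Pow {1..n}"
    and inv: "\<And>T. T \<in> S \<Longrightarrow> inv_into UNIV \<sigma> ` T \<in> S" and f: "f \<in> signed_kernel n S"
  shows "wr_act a \<sigma> f \<in> signed_kernel n S"
proof -
  have "signed_sum n T (wr_act a \<sigma> f) = 0" if "T \<in> S" for T
  proof -
    have "T \<subseteq> {1..n}" using that S by auto
    moreover have "signed_sum n (inv_into UNIV \<sigma> ` T) f = 0"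
      using inv[OF that] f by (auto simp: signed_kernel_def)
    ultimately show ?thesis by (simp only: signed_sum_wr_act[OF \<sigma>] mult_zero_right)
  qed
  moreover have "wr_act a \<sigma> f \<in> P_gr n" using f wr_act_P_gr[OF \<sigma>] by (auto simp: signed_kernel_def)
  ultimately show ?thesis by (simp add: signed_kernel_def)
qed

text \<open>These are the diagonal entries whose sum is the trace. By duality such an entry vanishes
  unless the inverse of \<sigma> fixes \<open>T\<close> as a set, and then the renaming sign is the
  sign of \<sigma> on \<open>T\<close>.\<close>

lemma signed_sum_wr_act_canonical:
  fixes a :: "nat \<Rightarrow> 'a::field"
  assumes \<sigma>: "\<sigma> permutes {1..n}" and T: "T \<subseteq> {1..n}"
  shows "signed_sum n T (wr_act a \<sigma> (word_monomial (canonical_word n T)))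
     = (if \<sigma> ` T = T then of_int (sign_on T \<sigma>) * (\<Prod>j\<in>T. a j) else 0)"
proof -
  let ?i = "inv_into UNIV \<sigma>"
  have i: "?i (\<sigma> x) = x" "\<sigma> (?i x) = x" for x using permutes_inverses[OF \<sigma>] by auto
  have iT: "?i ` T \<subseteq> {1..n}"
    using image_mono[OF T, of ?i] permutes_image[OF permutes_inv[OF \<sigma>]] by simp
  have fin: "finite T" using T finite_subset by blast
  have eq: "?i ` T = T \<longleftrightarrow> \<sigma> ` T = T"
  proof
    assume "?i ` T = T"
    hence "\<sigma> ` (?i ` T) = \<sigma> ` T" by simp
    thus "\<sigma> ` T = T" by (simp add: image_image i)
  next
    assume "\<sigma> ` T = T"
    hence "?i ` (\<sigma> ` T) = ?i ` T" by simp
    thus "?i ` T = T" by (simp add: image_image i)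
  qed
  have *: "signed_sum n T (wr_act a \<sigma> (word_monomial (canonical_word n T)))
     = (\<Prod>j\<in>T. a j) * of_int (list_sign (map \<sigma> (sorted_list_of_set (?i ` T))))
        * (if ?i ` T = T then 1 else 0)"
    unfolding signed_sum_wr_act[OF \<sigma> T] signed_sum_canonical[OF iT T] ..
  show ?thesis
  proof (cases "\<sigma> ` T = T")
    case True
    have "bij_betw \<sigma> T T" using True permutes_inj[OF \<sigma>] by (auto simp: bij_betw_def intro: inj_on_subset)
    hence "list_sign (map \<sigma> (sorted_list_of_set T)) = sign_on T \<sigma>"
      using list_sign_map_sign_on[of "sorted_list_of_set T" \<sigma>] fin list_sign_sorted_list_of_set[OF fin]
      by simp
    thus ?thesis using True eq unfolding * by simp
  next
    case False
    thus ?thesis using eq unfolding * by simp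
  qed
qed

text \<open>The row gives the trivial character and the column the sign. Subsets that are not stable
  are kept with value 0, so that the summand agrees with the diagonal entry of the action at every
  \<open>T\<close>.\<close>

lemma wr_char_row_column:
  fixes a :: "nat \<Rightarrow> 'a::field_char_0"
  assumes \<sigma>: "\<sigma> permutes {1..n}" and "i \<le> n"
  shows "wr_char (row_part (n - i)) (col_part i) n a \<sigma>
    = (\<Sum>T | T \<subseteq> {1..n} \<and> card T = i. if \<sigma> ` T = T then of_int (sign_on T \<sigma>) * (\<Prod>j\<in>T. a j) else 0)"
proof -
  have bij: "bij_betw \<sigma> {1..n} {1..n}" by (rule permutes_imp_bij[OF \<sigma>])
  have inj: "inj_on \<sigma> S" for S using permutes_inj[OF \<sigma>] by (rule inj_on_subset) simp
  have "wr_char (row_part (n - i)) (col_part i) n a \<sigma>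
     = (\<Sum>T | T \<subseteq> {1..n} \<and> card T = i \<and> \<sigma> ` T = T. of_int (sign_on T \<sigma>) * (\<Prod>j\<in>T. a j))"
    unfolding wr_char_def
  proof (rule sum.cong)
    fix T assume "T \<in> {T. T \<subseteq> {1..n} \<and> card T = i \<and> \<sigma> ` T = T}"
    hence T: "T \<subseteq> {1..n}" "card T = i" "\<sigma> ` T = T" by auto
    have fin: "finite T" using T(1) finite_subset by blast
    have "sym_char (col_part i) T \<sigma> = sign_on T \<sigma>"
      using T inj by (intro sym_char_column fin) (auto simp: bij_betw_def)
    moreover have "\<sigma> ` ({1..n} - T) = {1..n} - T"
      by (rule image_diff_inv[OF permutes_image[OF \<sigma>] T(3,1) inj])
    hence "sym_char (row_part (n - i)) ({1..n} - T) \<sigma> = 1"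
      using T card_Diff_subset[OF fin T(1)] by (intro sym_char_row) auto
    ultimately show "of_int (sym_char (row_part (n - i)) ({1..n} - T) \<sigma> * sym_char (col_part i) T \<sigma>)
        * (\<Prod>j\<in>T. a j) = of_int (sign_on T \<sigma>) * (\<Prod>j\<in>T. a j)" by simp
  qed (simp add: col_part_def sum_list_replicate)
  also have "\<dots> = (\<Sum>T | T \<subseteq> {1..n} \<and> card T = i.
      if \<sigma> ` T = T then of_int (sign_on T \<sigma>) * (\<Prod>j\<in>T. a j) else 0)"
    by (rule sum.mono_neutral_cong_left) auto
  finally show ?thesis .
qed

section \<open>Subsets counted by size and parity\<close>

lemma sum_over_subsets_by_card:
  assumes "finite X" "\<And>i. Q i \<Longrightarrow> i \<le> card X \<Longrightarrow> i \<in> I" "finite I" "\<And>i. i \<in> I \<Longrightarrow> Q i"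
  shows "(\<Sum>i\<in>I. \<Sum>T | T \<subseteq> X \<and> card T = i. h T) = (\<Sum>T | T \<subseteq> X \<and> Q (card T). h T)"
proof -
  have "(\<Sum>i\<in>I. sum h {T \<in> {T. T \<subseteq> X \<and> Q (card T)}. card T = i}) = sum h {T. T \<subseteq> X \<and> Q (card T)}"
    by (rule sum.group) (use assms card_mono[OF assms(1)] in auto)
  moreover have "{T \<in> {T. T \<subseteq> X \<and> Q (card T)}. card T = i} = {T. T \<subseteq> X \<and> card T = i}" if "i \<in> I" for i
    using assms(4)[OF that] by auto
  ultimately show ?thesis by simp
qed

lemma card_even_subsets:
  "card {T. T \<subseteq> {1..n} \<and> even (card T)} = (\<Sum>i | i \<le> n \<and> even i. n choose i)"
proof -
  have "card {T. T \<subseteq> {1..n} \<and> even (card T)} = (\<Sum>T | T \<subseteq> {1..n} \<and> even (card T). 1)"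
    by (simp only: card_eq_sum)
  also have "\<dots> = (\<Sum>i | i \<le> n \<and> even i. \<Sum>T | T \<subseteq> {1..n} \<and> card T = i. 1)"
    by (rule sum_over_subsets_by_card[symmetric]) auto
  also have "\<dots> = (\<Sum>i | i \<le> n \<and> even i. n choose i)"
    by (simp only: card_eq_sum[symmetric] n_subsets[OF finite_atLeastAtMost] card_atLeastAtMost) simp
  finally show ?thesis .
qed

lemma card_odd_subsets:
  "card {T. T \<subseteq> {1..n} \<and> odd (card T)} = (\<Sum>i | 1 \<le> i \<and> i \<le> n \<and> odd i. n choose i)"
proof -
  have "card {T. T \<subseteq> {1..n} \<and> odd (card T)} = (\<Sum>T | T \<subseteq> {1..n} \<and> odd (card T). 1)"
    by (simp only: card_eq_sum)
  also have "\<dots> = (\<Sum>i | 1 \<le> i \<and> i \<le> n \<and> odd i. \<Sum>T | T \<subseteq> {1..n} \<and> card T = i. 1)"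
    by (rule sum_over_subsets_by_card[symmetric]) (auto simp: Suc_le_eq odd_pos)
  also have "\<dots> = (\<Sum>i | 1 \<le> i \<and> i \<le> n \<and> odd i. n choose i)"
    by (simp only: card_eq_sum[symmetric] n_subsets[OF finite_atLeastAtMost] card_atLeastAtMost) simp
  finally show ?thesis .
qed

lemma sum_even_choose:
  assumes "n \<ge> 1"
  shows "(\<Sum>i | i \<le> n \<and> even i. n choose i) = 2 ^ (n - 1)"
proof -
  have "int (\<Sum>i | i \<le> n \<and> even i. n choose i) = (\<Sum>i\<le>n. if even i then of_nat (n choose i) else 0)"
    by (simp add: sum.If_cases Int_def)
  hence "2 * int (\<Sum>i | i \<le> n \<and> even i. n choose i) = 2 ^ n"
    using choose_even_sum[of n, where ?'a = int] assms by simp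
  also have "\<dots> = 2 * int (2 ^ (n - 1))" using assms by (simp flip: power_Suc)
  finally show ?thesis by linarith
qed

lemma sum_odd_choose:
  assumes "n \<ge> 1"
  shows "(\<Sum>i | 1 \<le> i \<and> i \<le> n \<and> odd i. n choose i) = 2 ^ (n - 1)"
proof -
  have "{i. 1 \<le> i \<and> i \<le> n \<and> odd i} = {i. i \<le> n \<and> odd i}" by (auto simp: Suc_le_eq odd_pos)
  hence "int (\<Sum>i | 1 \<le> i \<and> i \<le> n \<and> odd i. n choose i) = (\<Sum>i\<le>n. if odd i then of_nat (n choose i) else 0)"
    by (simp add: sum.If_cases Int_def)
  hence "2 * int (\<Sum>i | 1 \<le> i \<and> i \<le> n \<and> odd i. n choose i) = 2 ^ n"
    using choose_odd_sum[of n, where ?'a = int] assms by simp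
  also have "\<dots> = 2 * int (2 ^ (n - 1))" using assms by (simp flip: power_Suc)
  finally show ?thesis by linarith
qed

theorem theorem5p5:
  fixes F :: "'a::field_char_0 itself" and n :: nat
  assumes "n \<ge> 1"
  shows "c_gr_z F n = (\<Sum>i | 1 \<le> i \<and> i \<le> n \<and> odd i. n choose i)
       \<and> (\<Sum>i | 1 \<le> i \<and> i \<le> n \<and> odd i. n choose i) = 2 ^ (n - 1)
       \<and> delta_gr F n = (\<Sum>i | i \<le> n \<and> even i. n choose i)
       \<and> (\<Sum>i | i \<le> n \<and> even i. n choose i) = 2 ^ (n - 1)
       \<and> (\<forall>(a :: nat \<Rightarrow> 'a) \<sigma>. \<sigma> permutes {1..n} \<and> (\<forall>j\<in>{1..n}. a j = 1 \<or> a j = -1) \<longrightarrow>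
            chi_gr_z n a \<sigma> =
              (\<Sum>i | 1 \<le> i \<and> i \<le> n \<and> odd i. wr_char (row_part (n - i)) (col_part i) n a \<sigma>))
       \<and> (\<forall>(a :: nat \<Rightarrow> 'a) \<sigma>. \<sigma> permutes {1..n} \<and> (\<forall>j\<in>{1..n}. a j = 1 \<or> a j = -1) \<longrightarrow>
            chi_Delta_gr n a \<sigma> =
              (\<Sum>i | i \<le> n \<and> even i. wr_char (row_part (n - i)) (col_part i) n a \<sigma>))"
proof -
  define Od where "Od = {T. T \<subseteq> {1..n} \<and> odd (card T)}"
  define Ev where "Ev = {T. T \<subseteq> {1..n} \<and> even (card T)}"
  have OE: "Od \<union> Ev = Pow {1..n}" "Od \<inter> Ev = {}" "Od \<subseteq> Pow {1..n}" "Ev \<subseteq> Pow {1..n}"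
    by (auto simp: Od_def Ev_def)
  \<comment> \<open>Multilinear polynomials, the central ones and the identities form a chain of
    signed kernels: the first step imposes the odd functionals, the second the even ones.\<close>
  have P: "(P_gr n :: 'a fpoly set) = signed_kernel n {}" by (simp add: signed_kernel_def)
  have C: "(P_gr n \<inter> C_gr :: 'a fpoly set) = signed_kernel n Od"
    unfolding P_gr_Int_C_gr[OF assms] signed_kernel_def Od_def ..
  have I: "(P_gr n \<inter> Id_gr :: 'a fpoly set) = signed_kernel n (Od \<union> Ev)"
    unfolding P_gr_Int_Id_gr signed_kernel_def OE(1) ..
  have "c_gr_z F n = card Od"
    using fdim_signed_kernel_and_trace(1)[of "{}" n Od, where ?'a = 'a] OE
    unfolding c_gr_z_def C unfolding P by simp
  moreover have "delta_gr F n = card Ev"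
    using fdim_signed_kernel_and_trace(1)[of Od n Ev, where ?'a = 'a] OE
    unfolding delta_gr_def C I by simp
  moreover have "chi_gr_z n a \<sigma> = (\<Sum>i | 1 \<le> i \<and> i \<le> n \<and> odd i. wr_char (row_part (n - i)) (col_part i) n a \<sigma>)
     \<and> chi_Delta_gr n a \<sigma> = (\<Sum>i | i \<le> n \<and> even i. wr_char (row_part (n - i)) (col_part i) n a \<sigma>)"
    if \<sigma>: "\<sigma> permutes {1..n}" for a :: "nat \<Rightarrow> 'a" and \<sigma>
  proof -
    let ?g = "wr_act a \<sigma>" and ?i = "inv_into UNIV \<sigma>"
    let ?h = "\<lambda>T. if \<sigma> ` T = T then of_int (sign_on T \<sigma>) * (\<Prod>j\<in>T. a j) else 0"
    have g: "?g (x + y) = ?g x + ?g y" "?g (fscale c x) = fscale c (?g x)" for x y c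
      by (simp_all add: wr_act_def fun_eq_iff algebra_simps)
    have i_perm: "?i permutes {1..n}" by (rule permutes_inv[OF \<sigma>])
    have i_sub: "?i ` T \<subseteq> {1..n}" if "T \<subseteq> {1..n}" for T
      using image_mono[OF that, of ?i] permutes_image[OF i_perm] by simp
    have i_card: "card (?i ` T) = card T" for T
      by (intro card_image inj_on_subset[OF permutes_inj[OF i_perm]]) simp
    have gP: "?g f \<in> signed_kernel n {}" if "f \<in> signed_kernel n {}" for f
      by (rule wr_act_signed_kernel[OF \<sigma> _ _ that]) auto
    \<comment> \<open>The inverse of \<sigma> preserves cardinalities and hence permutes the odd
      subsets among themselves.\<close>
    have gC: "?g f \<in> signed_kernel n Od" if "f \<in> signed_kernel n Od" for f
      by (rule wr_act_signed_kernel[OF \<sigma> OE(3) _ that]) (use i_sub i_card in \<open>auto simp: Od_def\<close>)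
    have gI: "?g f \<in> signed_kernel n (Od \<union> Ev)" if "f \<in> signed_kernel n (Od \<union> Ev)" for f
      by (rule wr_act_signed_kernel[OF \<sigma> _ _ that]) (use i_sub OE(1) in auto)
    have "quot_trace (signed_kernel n {}) (signed_kernel n ({} \<union> Od)) ?g
        = (\<Sum>T\<in>Od. signed_sum n T (?g (word_monomial (canonical_word n T))))"
      by (rule fdim_signed_kernel_and_trace(2)) (use OE g gP gC in auto)
    hence "chi_gr_z n a \<sigma> = (\<Sum>T\<in>Od. signed_sum n T (?g (word_monomial (canonical_word n T))))"
      unfolding chi_gr_z_def C unfolding P by simp
    also have "\<dots> = sum ?h Od"
      by (rule sum.cong[OF refl], rule signed_sum_wr_act_canonical[OF \<sigma>]) (simp add: Od_def)
    also have "\<dots> = (\<Sum>i | 1 \<le> i \<and> i \<le> n \<and> odd i. \<Sum>T | T \<subseteq> {1..n} \<and> card T = i. ?h T)"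
      unfolding Od_def by (rule sum_over_subsets_by_card[symmetric]) (auto simp: Suc_le_eq odd_pos)
    also have "\<dots> = (\<Sum>i | 1 \<le> i \<and> i \<le> n \<and> odd i. wr_char (row_part (n - i)) (col_part i) n a \<sigma>)"
      by (rule sum.cong[OF refl], rule wr_char_row_column[OF \<sigma>, symmetric]) simp
    finally have 1: "chi_gr_z n a \<sigma>
       = (\<Sum>i | 1 \<le> i \<and> i \<le> n \<and> odd i. wr_char (row_part (n - i)) (col_part i) n a \<sigma>)" .
    have "quot_trace (signed_kernel n Od) (signed_kernel n (Od \<union> Ev)) ?g
        = (\<Sum>T\<in>Ev. signed_sum n T (?g (word_monomial (canonical_word n T))))"
      by (rule fdim_signed_kernel_and_trace(2)) (use OE g gC gI in auto)
    hence "chi_Delta_gr n a \<sigma> = (\<Sum>T\<in>Ev. signed_sum n T (?g (word_monomial (canonical_word n T))))"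
      unfolding chi_Delta_gr_def C I .
    also have "\<dots> = sum ?h Ev"
      by (rule sum.cong[OF refl], rule signed_sum_wr_act_canonical[OF \<sigma>]) (simp add: Ev_def)
    also have "\<dots> = (\<Sum>i | i \<le> n \<and> even i. \<Sum>T | T \<subseteq> {1..n} \<and> card T = i. ?h T)"
      unfolding Ev_def by (rule sum_over_subsets_by_card[symmetric]) auto
    also have "\<dots> = (\<Sum>i | i \<le> n \<and> even i. wr_char (row_part (n - i)) (col_part i) n a \<sigma>)"
      by (rule sum.cong[OF refl], rule wr_char_row_column[OF \<sigma>, symmetric]) simp
    finally show ?thesis using 1 by simp
  qed
  ultimately show ?thesis
    using card_odd_subsets[of n] card_even_subsets[of n] sum_odd_choose[OF assms] sum_even_choose[OF assms]
    unfolding Od_def Ev_def by (intro conjI allI impI) simp_all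
qed

end
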